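(* Let $n\ge 1$ and let $M\subset\mathbb{C}^{n+1}$ be a connected, oriented, smooth embedded pseudoconvex real hypersurface whose Levi curvature $H$ is a non-zero constant and such that $h(Z,W)=0$ for all $Z,W\in\mathcal{H}$ (i.e. $h_{\alpha\beta}=0$). Then, up to a complex isometry of $\mathbb{C}^{n+1}$, $M$ is contained in a sphere or in a cylinder of the form $$\Big\{z\in\mathbb{C}^{n+1}:\sum_{i=m}^{n+1}|z_i|^2=r^2\Big\},\qquad r>0,\quad 1\le m\le n.$$
   Context: Setting. $J$ is the standard complex structure of $\mathbb{C}^{n+1}$ and $D$ is the standard flat connection, extended complex-linearly to complex vector fields. $g$ is the $\mathbb{C}$-bilinear extension of the Euclidean metric of $\mathbb{C}^{n+1}=\mathbb{R}^{2n+2}$ to complexified tangent vectors, so that $g(\partial_{z_h},\partial_{\bar z_k})=\tfrac12\delta_{hk}$ and $g(\partial_{z_h},\partial_{z_k})=g(\partial_{\bar z_h},\partial_{\bar z_k})=0$. $M$ has real dimension $2n+1$ and is oriented by a smooth real unit normal $\nu$. $\mathcal{H}=T^{1,0}M$ is the holomorphic tangent bundle of $M$, i.e. $\mathcal{H}=T^{1,0}\mathbb{C}^{n+1}\cap \mathbb{C}TM$, where $\mathbb{C}TM$ is the complexified tangent bundle; it has complex rank $n$. The second fundamental form of $M$, extended $\mathbb{C}$-bilinearly to $\mathbb{C}TM$, is $h(Z,W)=g(Z,D_W\nu)$. The Levi form is the hermitian form $(Z,W)\mapsto h(Z,\bar W)$ on $\mathcal{H}$. The Levi curvature is its normalized trace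 $H=\frac1n\sum_{\alpha,\beta=1}^n g^{\alpha\bar\beta}h(Z_\alpha,\bar Z_\beta)$, where $Z_1,\dots,Z_n$ is any local frame of $\mathcal{H}$, $g_{\alpha\bar\beta}=g(Z_\alpha,\bar Z_\beta)$, and $g^{\alpha\bar\beta}$ is determined by $\sum_\beta g^{\alpha\bar\beta}g_{\gamma\bar\beta}=\delta_{\alpha\gamma}$. The notation $h_{\alpha\beta}$ means $h(Z_\alpha,Z_\beta)$. $M$ is pseudoconvex if, for a suitable choice of the global unit normal $\nu$ (i.e. possibly replacing $\nu$ by $-\nu$), the Levi form is positive semidefinite at every point: $h(Z,\bar Z)\ge 0$ for all $Z\in\mathcal{H}$. A complex isometry of $\mathbb{C}^{n+1}$ is a map $z\mapsto Uz+b$ with $U$ unitary and $b\in\mathbb{C}^{n+1}$. *)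

theory Defs
  imports "HOL-Analysis.Analysis"
begin

section \<open>Smooth maps and real hypersurfaces of \<open>\<complex>\<^sup>n\<^sup>+\<^sup>1\<close>\<close>

primrec Ck_on :: "nat \<Rightarrow> ('a::euclidean_space \<Rightarrow> 'b::real_normed_vector) \<Rightarrow> 'a set \<Rightarrow> bool" where
  "Ck_on 0 f S \<longleftrightarrow> continuous_on S f"
| "Ck_on (Suc k) f S \<longleftrightarrow>
     (\<forall>x\<in>S. f differentiable (at x)) \<and>
     (\<forall>v. Ck_on k (\<lambda>x. frechet_derivative f (at x) v) S)"

text \<open>Only meaningful for open sets, since the derivatives are taken in the ambient space.\<close>

definition smooth_on_open :: "('a::euclidean_space \<Rightarrow> 'b::real_normed_vector) \<Rightarrow> 'a set \<Rightarrow> bool" where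
  "smooth_on_open f S \<longleftrightarrow> open S \<and> (\<forall>k. Ck_on k f S)"

definition smooth_along :: "('a::euclidean_space \<Rightarrow> 'b::real_normed_vector) \<Rightarrow> 'a set \<Rightarrow> bool" where
  "smooth_along f M \<longleftrightarrow>
     (\<forall>p\<in>M. \<exists>V F. p \<in> V \<and> smooth_on_open F V \<and> (\<forall>x\<in>M \<inter> V. F x = f x))"

definition local_defining_function ::
    "(complex ^ 'k) set \<Rightarrow> (complex ^ 'k) set \<Rightarrow> (complex ^ 'k \<Rightarrow> real) \<Rightarrow> bool" where
  "local_defining_function M V \<rho> \<longleftrightarrow>
     smooth_on_open \<rho> V \<and> M \<inter> V = {x \<in> V. \<rho> x = 0} \<and>
     (\<forall>x\<in>V. frechet_derivative \<rho> (at x) \<noteq> (\<lambda>v. 0))"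

text \<open>Embedded, but not necessarily closed.\<close>

definition smooth_hypersurface :: "(complex ^ 'k) set \<Rightarrow> bool" where
  "smooth_hypersurface M \<longleftrightarrow> (\<forall>p\<in>M. \<exists>V \<rho>. p \<in> V \<and> local_defining_function M V \<rho>)"

text \<open>The kernel of \<open>d\<rho>\<close> at \<open>p\<close> is the same for all local defining functions \<open>\<rho>\<close> near \<open>p\<close>.\<close>

definition tangent_space :: "(complex ^ 'k) set \<Rightarrow> complex ^ 'k \<Rightarrow> (complex ^ 'k) set" where
  "tangent_space M p =
     {X. \<exists>V \<rho>. p \<in> V \<and> local_defining_function M V \<rho> \<and> frechet_derivative \<rho> (at p) X = 0}"

text \<open>The real inner product of \<^typ>\<open>complex ^ 'k\<close> is the Euclidean one of the underlying real space.\<close>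

definition unit_normal_field :: "(complex ^ 'k) set \<Rightarrow> (complex ^ 'k \<Rightarrow> complex ^ 'k) \<Rightarrow> bool" where
  "unit_normal_field M \<nu> \<longleftrightarrow>
     smooth_along \<nu> M \<and>
     (\<forall>p\<in>M. norm (\<nu> p) = 1 \<and> (\<forall>X\<in>tangent_space M p. X \<bullet> \<nu> p = 0))"

section \<open>Complexified tangent vectors\<close>

text \<open>The pair \<open>(X, Y)\<close> of real tangent vectors stands for \<open>X + \<i> Y\<close> in the complexification.
  This \<open>\<i>\<close> is not the complex structure \<open>J\<close>, which is the multiplication by \<^term>\<open>\<i>\<close> in
  \<^typ>\<open>complex ^ 'k\<close>.\<close>

type_synonym 'k cvec = "(complex ^ 'k) \<times> (complex ^ 'k)"

definition cscale :: "complex \<Rightarrow> 'k::finite cvec \<Rightarrow> 'k cvec" where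
  "cscale c Z = (Re c *\<^sub>R fst Z - Im c *\<^sub>R snd Z, Re c *\<^sub>R snd Z + Im c *\<^sub>R fst Z)"

definition cbar :: "'k::finite cvec \<Rightarrow> 'k cvec" where
  "cbar Z = (fst Z, - snd Z)"

definition complexify :: "(complex ^ 'k \<Rightarrow> complex ^ 'k) \<Rightarrow> 'k::finite cvec \<Rightarrow> 'k cvec" where
  "complexify A Z = (A (fst Z), A (snd Z))"

definition gC :: "'k::finite cvec \<Rightarrow> 'k cvec \<Rightarrow> complex" where
  "gC Z W = Complex (fst Z \<bullet> fst W - snd Z \<bullet> snd W) (fst Z \<bullet> snd W + snd Z \<bullet> fst W)"

definition JC :: "'k::finite cvec \<Rightarrow> 'k cvec" where
  "JC = complexify (\<lambda>X. \<i> *s X)"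

definition T10 :: "'k::finite cvec set" where
  "T10 = {Z. JC Z = cscale \<i> Z}"

definition complex_tangent_space :: "(complex ^ 'k) set \<Rightarrow> complex ^ 'k \<Rightarrow> 'k cvec set" where
  "complex_tangent_space M p = tangent_space M p \<times> tangent_space M p"

definition hol_tangent_space :: "(complex ^ 'k) set \<Rightarrow> complex ^ 'k \<Rightarrow> 'k::finite cvec set" where
  "hol_tangent_space M p = T10 \<inter> complex_tangent_space M p"

section \<open>Second fundamental form and Levi curvature\<close>

text \<open>\<open>\<nu>\<close> is only relevant on \<open>M\<close>, so it is differentiated within \<open>M\<close>; this derivative is
  uniquely determined on tangent vectors of \<open>M\<close>, the only ones it is applied to.\<close>

definition second_ff ::
    "(complex ^ 'k) set \<Rightarrow> (complex ^ 'k \<Rightarrow> complex ^ 'k) \<Rightarrow> complex ^ 'k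
      \<Rightarrow> 'k::finite cvec \<Rightarrow> 'k cvec \<Rightarrow> complex" where
  "second_ff M \<nu> p Z W = gC Z (complexify (frechet_derivative \<nu> (at p within M)) W)"

definition levi_psd :: "(complex ^ 'k::finite) set \<Rightarrow> (complex ^ 'k \<Rightarrow> complex ^ 'k) \<Rightarrow> bool" where
  "levi_psd M \<nu> \<longleftrightarrow>
     (\<forall>p\<in>M. \<forall>Z\<in>hol_tangent_space M p. second_ff M \<nu> p Z (cbar Z) \<in> \<real>\<^sub>\<ge>\<^sub>0)"

definition pseudoconvex :: "(complex ^ 'k::finite) set \<Rightarrow> (complex ^ 'k \<Rightarrow> complex ^ 'k) \<Rightarrow> bool" where
  "pseudoconvex M \<nu> \<longleftrightarrow> levi_psd M \<nu> \<or> levi_psd M (\<lambda>p. - \<nu> p)"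

text \<open>The values at \<open>p\<close> of local frames of the holomorphic tangent bundle, i.e. the complex bases
  of its fibre.\<close>

definition hol_frame_at ::
    "nat \<Rightarrow> (complex ^ 'k::finite) set \<Rightarrow> complex ^ 'k \<Rightarrow> (nat \<Rightarrow> 'k cvec) \<Rightarrow> bool" where
  "hol_frame_at n M p Z \<longleftrightarrow>
     (\<forall>\<alpha>\<in>{1..n}. Z \<alpha> \<in> hol_tangent_space M p) \<and>
     (\<forall>c. (\<Sum>\<alpha>=1..n. cscale (c \<alpha>) (Z \<alpha>)) = 0 \<longrightarrow> (\<forall>\<alpha>\<in>{1..n}. c \<alpha> = 0)) \<and>
     (\<forall>W\<in>hol_tangent_space M p. \<exists>c. W = (\<Sum>\<alpha>=1..n. cscale (c \<alpha>) (Z \<alpha>)))"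

definition inverse_metric :: "nat \<Rightarrow> (nat \<Rightarrow> 'k::finite cvec) \<Rightarrow> (nat \<Rightarrow> nat \<Rightarrow> complex) \<Rightarrow> bool" where
  "inverse_metric n Z G \<longleftrightarrow>
     (\<forall>\<alpha>\<in>{1..n}. \<forall>\<gamma>\<in>{1..n}.
        (\<Sum>\<beta>=1..n. G \<alpha> \<beta> * gC (Z \<gamma>) (cbar (Z \<beta>))) = (if \<alpha> = \<gamma> then 1 else 0))"

text \<open>The trace does not depend on the frame, so \<open>H\<close> is unique.\<close>

definition has_levi_curvature ::
    "nat \<Rightarrow> (complex ^ 'k::finite) set \<Rightarrow> (complex ^ 'k \<Rightarrow> complex ^ 'k) \<Rightarrow> complex ^ 'k
      \<Rightarrow> complex \<Rightarrow> bool" where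
  "has_levi_curvature n M \<nu> p H \<longleftrightarrow>
     (\<exists>Z G. hol_frame_at n M p Z \<and> inverse_metric n Z G \<and>
        H = 1 / of_nat n *
            (\<Sum>\<alpha>=1..n. \<Sum>\<beta>=1..n. G \<alpha> \<beta> * second_ff M \<nu> p (Z \<alpha>) (cbar (Z \<beta>))))"

section \<open>Complex isometries and cylinders\<close>

definition unitary_matrix :: "complex ^ 'k ^ 'k \<Rightarrow> bool" where
  "unitary_matrix U \<longleftrightarrow>
     map_matrix cnj (transpose U) ** U = mat 1 \<and> U ** map_matrix cnj (transpose U) = mat 1"

definition complex_isometry :: "(complex ^ 'k \<Rightarrow> complex ^ 'k) \<Rightarrow> bool" where
  "complex_isometry \<Phi> \<longleftrightarrow> (\<exists>U b. unitary_matrix U \<and> \<Phi> = (\<lambda>z. U *v z + b))"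

text \<open>The bijection \<open>e\<close> from \<open>{1..n+1}\<close> to the index type fixes the order of the coordinates:
  \<open>z\<^sub>i\<close> is \<open>z $ e i\<close>.\<close>

definition spherical_cylinder ::
    "nat \<Rightarrow> (nat \<Rightarrow> 'k) \<Rightarrow> nat \<Rightarrow> real \<Rightarrow> (complex ^ 'k) set" where
  "spherical_cylinder n e m r = {z. (\<Sum>i=m..n+1. (cmod (z $ e i))\<^sup>2) = r\<^sup>2}"

end

theory Submission
  imports Defs
begin

text \<open>
  Let \<open>J\<close> be the multiplication by \<open>\<i>\<close>, \<open>A = D\<nu>\<close> the shape operator and \<open>c = h(J\<nu>, J\<nu>)\<close>.  The hypothesis
  \<open>h(Z, W) = 0\<close> says that the horizontal part \<open>B\<close> of \<open>A\<close> commutes with \<open>J\<close>.  Differentiating this and using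
  the Codazzi equation expresses the horizontal part of \<open>\<nabla>h\<close> through \<open>B\<close> and the mixed term
  \<open>\<theta> = h(J\<nu>, \<cdot>)\<close>; differentiating then the constant trace \<open>\<tau>\<close> of \<open>B\<close> gives \<open>\<tau>\<theta> + 4 B\<theta> = 0\<close>, so \<open>\<theta> = 0\<close>
  because \<open>B\<close> is semidefinite.  Differentiating \<open>\<theta> = 0\<close> and using the Codazzi equation again yields
  \<open>A\<^sup>2 = c A\<close> on the tangent space and, with one more derivative, that \<open>c \<noteq> 0\<close> is constant and \<open>\<nabla>h = 0\<close>.
  Hence the orthogonal projection \<open>P\<close> of \<open>\<complex>\<^sup>n\<^sup>+\<^sup>1\<close> onto the kernel of \<open>A\<close> in the tangent space is a
  constant complex-linear map, and \<open>(1 - P) x - \<nu>/c\<close> is constant on \<open>M\<close>, so \<open>|(1 - P) x - a| = 1/|c|\<close>.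
\<close>

section \<open>Calculus of \<open>C\<^sup>k\<close> functions\<close>

text \<open>The normal is given only on \<open>M\<close>, so it has no ambient second derivatives.
  The way round is to write it near each point as the gradient of a potential vanishing on
  \<open>M\<close>: then \<open>A\<close> is a Hessian, and the Codazzi equation is the symmetry of
  third derivatives in flat space. The potential is not the signed distance; its gradient has norm 1
  on \<open>M\<close> only, so \<open>A \<nu>\<close> need not vanish. It still has no tangential
  part, which is enough for the flat derivative \<open>t\<close> of \<open>A\<close> to agree with
  \<nabla>h on tangent vectors. Off the tangent space the Hessian depends on the potential. Global
  statements are therefore phrased through \<open>D \<nu>\<close> on tangent vectors, and the local
  Hessians are only compared there. The bound m \<le> n reflects that the range of 1 - P has complex
  dimension at least 2: it contains \<nu> and, since the trace of B is non-zero, also a horizontal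
  vector.\<close>

lemma Ck_on_cong:
  assumes "open S" "\<And>x. x \<in> S \<Longrightarrow> f x = g x" "Ck_on k f S"
  shows "Ck_on k g S"
  using assms(2,3)
proof (induction k arbitrary: f g)
  case 0
  then show ?case by (simp cong: continuous_on_cong)
next
  case (Suc k)
  have ev: "(g has_derivative D) (at x)" if "x \<in> S" "(f has_derivative D) (at x)" for x D
    using has_derivative_transform_within_open[OF that(2) assms(1) that(1)] Suc.prems(1) by simp
  have fr: "frechet_derivative f (at x) = frechet_derivative g (at x)" if "x \<in> S" for x
  proof -
    have "f differentiable (at x)" using Suc.prems(2) that by simp
    then have "(g has_derivative frechet_derivative f (at x)) (at x)"
      using ev that frechet_derivative_works by blast
    then show ?thesis using frechet_derivative_at by blast
  qed
  show ?case
  proof (simp, intro conjI ballI allI)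
    fix x assume "x \<in> S"
    then show "g differentiable at x"
      using ev Suc.prems(2) unfolding differentiable_def by (meson Ck_on.simps(2) differentiable_def)
  next
    fix v
    show "Ck_on k (\<lambda>x. frechet_derivative g (at x) v) S"
      by (rule Suc.IH[of "\<lambda>x. frechet_derivative f (at x) v"]) (use fr Suc.prems in auto)
  qed
qed

text \<open>\<open>Ck_on\<close> speaks about \<open>frechet_derivative\<close>; on an open set
  derivatives are unique, so any explicit one may be used in its place.\<close>

lemma Ck_on_SucI:
  assumes "open S" "\<And>x. x \<in> S \<Longrightarrow> (f has_derivative f' x) (at x)"
    and "\<And>v. Ck_on k (\<lambda>x. f' x v) S"
  shows "Ck_on (Suc k) f S"
proof -
  have "frechet_derivative f (at x) = f' x" if "x \<in> S" for x
    using frechet_derivative_at[OF assms(2)[OF that]] by simp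
  then show ?thesis
    using assms by (auto simp: differentiable_def intro: Ck_on_cong[OF assms(1) _ assms(3)])
qed

lemma Ck_on_SucD:
  assumes "Ck_on (Suc k) f S" "x \<in> S"
  shows "(f has_derivative frechet_derivative f (at x)) (at x)"
  using assms frechet_derivative_works by auto

lemma Ck_on_Suc_imp:
  "Ck_on (Suc k) f S \<Longrightarrow> Ck_on k f S"
proof (induction k arbitrary: f)
  case 0
  then show ?case
    by (auto intro!: continuous_at_imp_continuous_on differentiable_imp_continuous_within)
qed auto

lemma Ck_on_subset:
  assumes "Ck_on k f S" "T \<subseteq> S"
  shows "Ck_on k f T"
  using assms(1)
proof (induction k arbitrary: f)
  case 0
  then show ?case using assms(2) continuous_on_subset by auto
next
  case (Suc k)
  then show ?case using assms(2) by auto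
qed

lemma Ck_on_const: "open S \<Longrightarrow> Ck_on k (\<lambda>x. c) S"
proof (induction k arbitrary: c)
  case (Suc k)
  show ?case
    by (rule Ck_on_SucI[OF Suc.prems, where f' = "\<lambda>x v. 0"]) (use Suc in auto)
qed simp

lemma Ck_on_bounded_linear:
  assumes "open S" "bounded_linear L" "Ck_on k f S"
  shows "Ck_on k (\<lambda>x. L (f x)) S"
  using assms(3)
proof (induction k arbitrary: f)
  case 0
  then show ?case using bounded_linear.continuous_on[OF assms(2)] by simp
next
  case (Suc k)
  show ?case
    by (rule Ck_on_SucI[OF assms(1), where f' = "\<lambda>x v. L (frechet_derivative f (at x) v)"])
      (use Suc bounded_linear.has_derivative[OF assms(2) Ck_on_SucD[OF Suc.prems]] in auto)
qed

lemma Ck_on_add: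
  assumes "open S" "Ck_on k f S" "Ck_on k g S"
  shows "Ck_on k (\<lambda>x. f x + g x) S"
  using assms(2,3)
proof (induction k arbitrary: f g)
  case 0
  then show ?case by (auto intro: continuous_intros)
next
  case (Suc k)
  show ?case
    by (rule Ck_on_SucI[OF assms(1) has_derivative_add[OF Ck_on_SucD[OF Suc.prems(1)] Ck_on_SucD[OF Suc.prems(2)]]])
      (use Suc in auto)
qed

lemma Ck_on_sum:
  assumes "open S" "\<And>i. i \<in> I \<Longrightarrow> Ck_on k (f i) S"
  shows "Ck_on k (\<lambda>x. \<Sum>i\<in>I. f i x) S"
  using assms(2)
  by (induction I rule: infinite_finite_induct) (auto intro: Ck_on_const Ck_on_add assms(1))

lemma Ck_on_mult:
  fixes f g :: "'a::euclidean_space \<Rightarrow> real"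
  assumes "open S" "Ck_on k f S" "Ck_on k g S"
  shows "Ck_on k (\<lambda>x. f x * g x) S"
  using assms(2,3)
proof (induction k arbitrary: f g)
  case 0
  then show ?case by (auto intro: continuous_intros)
next
  case (Suc k)
  show ?case
    by (rule Ck_on_SucI[OF assms(1) has_derivative_mult[OF Ck_on_SucD[OF Suc.prems(1)] Ck_on_SucD[OF Suc.prems(2)]]])
      (use Suc Ck_on_Suc_imp[OF Suc.prems(1)] Ck_on_Suc_imp[OF Suc.prems(2)]
        in \<open>auto intro: Ck_on_add assms(1)\<close>)
qed

text \<open>The induction closes because the derivative of \<open>1 / f\<close> is a polynomial in
  \<open>1 / f\<close> and the derivative of \<open>f\<close>.\<close>

lemma Ck_on_inverse:
  fixes f :: "'a::euclidean_space \<Rightarrow> real"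
  assumes "open S" "Ck_on k f S" "\<And>x. x \<in> S \<Longrightarrow> f x \<noteq> 0"
  shows "Ck_on k (\<lambda>x. inverse (f x)) S"
  using assms(2,3)
proof (induction k)
  case 0
  then show ?case by (auto intro: continuous_intros)
next
  case (Suc k)
  have inv: "Ck_on k (\<lambda>x. inverse (f x)) S"
    using Suc Ck_on_Suc_imp by blast
  show ?case
  proof (rule Ck_on_SucI[OF assms(1)])
    fix x assume "x \<in> S"
    then show "((\<lambda>x. inverse (f x)) has_derivative
        (\<lambda>v. (- 1) * (inverse (f x) * frechet_derivative f (at x) v * inverse (f x)))) (at x)"
      using Deriv.has_derivative_inverse[OF _ Ck_on_SucD[OF Suc.prems(1)]] Suc.prems(2) by auto
  next
    fix v
    show "Ck_on k (\<lambda>x. (- 1) * (inverse (f x) * frechet_derivative f (at x) v * inverse (f x))) S"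
      using Suc.prems inv by (intro Ck_on_mult Ck_on_const assms(1)) auto
  qed
qed

lemma Ck_on_inner:
  fixes f g :: "'a::euclidean_space \<Rightarrow> 'b::euclidean_space"
  assumes "open S" "Ck_on k f S" "Ck_on k g S"
  shows "Ck_on k (\<lambda>x. f x \<bullet> g x) S"
proof -
  have "Ck_on k (\<lambda>x. \<Sum>b\<in>Basis. (f x \<bullet> b) * (g x \<bullet> b)) S"
    by (intro Ck_on_sum Ck_on_mult Ck_on_bounded_linear[OF assms(1) bounded_linear_inner_left] assms)
  then show ?thesis
    by (simp add: euclidean_inner[symmetric])
qed

text \<open>The second difference \<open>f(x+hv+hw) - f(x+hv) - f(x+hw) + f(x)\<close> is \<open>h\<^sup>2\<close> times a value of either
  mixed derivative near \<open>x\<close>.\<close>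

lemma second_difference_mvt:
  fixes f :: "'a::euclidean_space \<Rightarrow> real"
  assumes f: "Ck_on 2 f (ball x r)" and h: "0 < h" "h * (norm v + norm w) < r"
  obtains z where "norm (z - x) \<le> h * (norm v + norm w)"
    "f (x + h *\<^sub>R v + h *\<^sub>R w) - f (x + h *\<^sub>R v) - f (x + h *\<^sub>R w) + f x =
      h * h * frechet_derivative (\<lambda>y. frechet_derivative f (at y) v) (at z) w"
proof -
  define f1 where "f1 = (\<lambda>y. frechet_derivative f (at y) v)"
  have C1: "Ck_on (Suc 0) f1 (ball x r)" and C2: "Ck_on (Suc (Suc 0)) f (ball x r)"
    using f by (auto simp: f1_def numeral_2_eq_2)
  have nrm: "norm (a *\<^sub>R v + b *\<^sub>R w) \<le> h * (norm v + norm w)" if "0 \<le> a" "a \<le> h" "0 \<le> b" "b \<le> h" for a b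
  proof -
    have "norm (a *\<^sub>R v + b *\<^sub>R w) \<le> a * norm v + b * norm w"
      using norm_triangle_ineq[of "a *\<^sub>R v" "b *\<^sub>R w"] that by simp
    also have "\<dots> \<le> h * norm v + h * norm w"
      using that by (intro add_mono mult_right_mono) auto
    finally show ?thesis by (simp add: algebra_simps)
  qed
  have inb: "x + a *\<^sub>R v + b *\<^sub>R w \<in> ball x r" if "0 \<le> a" "a \<le> h" "0 \<le> b" "b \<le> h" for a b
  proof -
    have "dist x (x + a *\<^sub>R v + b *\<^sub>R w) = norm (a *\<^sub>R v + b *\<^sub>R w)"
      by (metis add.assoc add_diff_cancel_left' dist_commute dist_norm)
    then show ?thesis using nrm[OF that] h by simp
  qed
  \<comment> \<open>\<open>\<phi>\<close> moves along \<open>v\<close> with the increment along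
    \<open>w\<close> frozen, so its derivative is an increment of \<open>f1\<close> along
    \<open>w\<close>. A second mean value step, for \<open>\<psi>\<close>, turns that increment into
    a mixed derivative.\<close>
  define \<phi> where "\<phi> a = f (x + a *\<^sub>R v + h *\<^sub>R w) - f (x + a *\<^sub>R v)" for a
  have d\<phi>: "(\<phi> has_real_derivative (f1 (x + a *\<^sub>R v + h *\<^sub>R w) - f1 (x + a *\<^sub>R v))) (at a)"
    if a: "0 \<le> a" "a \<le> h" for a
  proof -
    have 1: "(f has_derivative frechet_derivative f (at (x + a *\<^sub>R v + h *\<^sub>R w))) (at (x + a *\<^sub>R v + h *\<^sub>R w))"
      using Ck_on_SucD[OF C2 inb[of a h]] a h by simp
    have 2: "(f has_derivative frechet_derivative f (at (x + a *\<^sub>R v))) (at (x + a *\<^sub>R v))"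
      using Ck_on_SucD[OF C2 inb[of a 0]] a h by simp
    have l1: "linear (frechet_derivative f (at (x + a *\<^sub>R v + h *\<^sub>R w)))" and
      l2: "linear (frechet_derivative f (at (x + a *\<^sub>R v)))"
      using 1 2 has_derivative_linear by auto
    have "(\<phi> has_derivative (\<lambda>s. frechet_derivative f (at (x + a *\<^sub>R v + h *\<^sub>R w)) (s *\<^sub>R v)
        - frechet_derivative f (at (x + a *\<^sub>R v)) (s *\<^sub>R v))) (at a)"
      unfolding \<phi>_def
    proof (rule has_derivative_diff)
      show "((\<lambda>a. f (x + a *\<^sub>R v + h *\<^sub>R w)) has_derivative
          (\<lambda>s. frechet_derivative f (at (x + a *\<^sub>R v + h *\<^sub>R w)) (s *\<^sub>R v))) (at a)"
        by (rule has_derivative_compose[where g = f and f = "\<lambda>a. x + a *\<^sub>R v + h *\<^sub>R w", OF _ 1])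
          (auto intro!: derivative_eq_intros)
      show "((\<lambda>a. f (x + a *\<^sub>R v)) has_derivative
          (\<lambda>s. frechet_derivative f (at (x + a *\<^sub>R v)) (s *\<^sub>R v))) (at a)"
        by (rule has_derivative_compose[where g = f and f = "\<lambda>a. x + a *\<^sub>R v", OF _ 2])
          (auto intro!: derivative_eq_intros)
    qed
    then show ?thesis
      unfolding has_field_derivative_def f1_def
      by (rule has_derivative_eq_rhs)
        (simp add: fun_eq_iff linear_cmul[OF l1] linear_cmul[OF l2] right_diff_distrib mult.commute)
  qed
  obtain a where a: "0 < a" "a < h" and
    \<phi>: "\<phi> h - \<phi> 0 = (h - 0) * (f1 (x + a *\<^sub>R v + h *\<^sub>R w) - f1 (x + a *\<^sub>R v))"
    using MVT2[of 0 h \<phi> "\<lambda>a. f1 (x + a *\<^sub>R v + h *\<^sub>R w) - f1 (x + a *\<^sub>R v)"] d\<phi> h by auto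
  define \<psi> where "\<psi> b = f1 (x + a *\<^sub>R v + b *\<^sub>R w)" for b
  have d\<psi>: "(\<psi> has_real_derivative frechet_derivative f1 (at (x + a *\<^sub>R v + b *\<^sub>R w)) w) (at b)"
    if b: "0 \<le> b" "b \<le> h" for b
  proof -
    have 1: "(f1 has_derivative frechet_derivative f1 (at (x + a *\<^sub>R v + b *\<^sub>R w))) (at (x + a *\<^sub>R v + b *\<^sub>R w))"
      using Ck_on_SucD[OF C1 inb[of a b]] a b by simp
    have l1: "linear (frechet_derivative f1 (at (x + a *\<^sub>R v + b *\<^sub>R w)))"
      using 1 has_derivative_linear by auto
    have "(\<psi> has_derivative (\<lambda>s. frechet_derivative f1 (at (x + a *\<^sub>R v + b *\<^sub>R w)) (s *\<^sub>R w))) (at b)"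
      unfolding \<psi>_def
      by (rule has_derivative_compose[where g = f1 and f = "\<lambda>b. x + a *\<^sub>R v + b *\<^sub>R w", OF _ 1])
        (auto intro!: derivative_eq_intros)
    then show ?thesis
      unfolding has_field_derivative_def
      by (rule has_derivative_eq_rhs) (simp add: fun_eq_iff linear_cmul[OF l1] mult.commute)
  qed
  obtain b where b: "0 < b" "b < h" and
    \<psi>: "\<psi> h - \<psi> 0 = (h - 0) * frechet_derivative f1 (at (x + a *\<^sub>R v + b *\<^sub>R w)) w"
    using MVT2[of 0 h \<psi> "\<lambda>b. frechet_derivative f1 (at (x + a *\<^sub>R v + b *\<^sub>R w)) w"] d\<psi> h by auto
  show thesis
  proof
    show "norm (x + a *\<^sub>R v + b *\<^sub>R w - x) \<le> h * (norm v + norm w)"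
      using nrm[of a b] a b by (simp add: add.assoc)
    show "f (x + h *\<^sub>R v + h *\<^sub>R w) - f (x + h *\<^sub>R v) - f (x + h *\<^sub>R w) + f x =
      h * h * frechet_derivative (\<lambda>y. frechet_derivative f (at y) v) (at (x + a *\<^sub>R v + b *\<^sub>R w)) w"
      using \<phi> \<psi> by (simp add: \<phi>_def \<psi>_def f1_def algebra_simps)
  qed
qed

lemma second_difference_tendsto:
  fixes f :: "'a::euclidean_space \<Rightarrow> real"
  assumes "open S" "x \<in> S" "Ck_on 2 f S"
  shows "((\<lambda>h. (f (x + h *\<^sub>R v + h *\<^sub>R w) - f (x + h *\<^sub>R v) - f (x + h *\<^sub>R w) + f x) / (h * h)) \<longlongrightarrow>
     frechet_derivative (\<lambda>y. frechet_derivative f (at y) v) (at x) w) (at_right 0)"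
proof -
  define G where "G = (\<lambda>z. frechet_derivative (\<lambda>y. frechet_derivative f (at y) v) (at z) w)"
  obtain r where r: "r > 0" "ball x r \<subseteq> S" using assms openE by blast
  have contG: "continuous_on S G" using assms(3) by (simp add: G_def numeral_2_eq_2)
  then have G: "isCont G x" using assms continuous_on_eq_continuous_at by blast
  \<comment> \<open>The summand 1 keeps the later divisor positive when \<open>v\<close> and
    \<open>w\<close> both vanish.\<close>
  define N where "N = norm v + norm w + 1"
  have N: "N > 0" "norm v + norm w \<le> N" by (auto simp: N_def add_nonneg_pos)
  show ?thesis
    unfolding tendsto_iff
  proof (intro allI impI)
    fix \<epsilon> :: real assume "\<epsilon> > 0"
    then obtain d where d: "d > 0" "\<And>z. norm (z - x) < d \<Longrightarrow> dist (G z) (G x) < \<epsilon>"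
      using G unfolding continuous_at_eps_delta dist_norm by blast
    define m where "m = min (d / N) (r / N)"
    have m: "m > 0" using d r N by (simp add: m_def)
    have "dist ((f (x + h *\<^sub>R v + h *\<^sub>R w) - f (x + h *\<^sub>R v) - f (x + h *\<^sub>R w) + f x) / (h * h)) (G x) < \<epsilon>"
      if h: "0 < h" "h < m" for h
    proof -
      have hN: "h * N < d" "h * N < r" using h N by (auto simp: m_def field_simps)
      have le: "h * (norm v + norm w) \<le> h * N" using h N by (intro mult_left_mono) auto
      obtain z where z: "norm (z - x) \<le> h * (norm v + norm w)"
        "f (x + h *\<^sub>R v + h *\<^sub>R w) - f (x + h *\<^sub>R v) - f (x + h *\<^sub>R w) + f x = h * h * G z"
        using second_difference_mvt[of f x r h v w] Ck_on_subset[OF assms(3) r(2)] h hN le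
        unfolding G_def by (metis order_le_less_trans)
      then show ?thesis using d(2)[of z] le hN h by simp
    qed
    then show "\<forall>\<^sub>F h in at_right 0. dist ((f (x + h *\<^sub>R v + h *\<^sub>R w) - f (x + h *\<^sub>R v) - f (x + h *\<^sub>R w) + f x) / (h * h))
        (frechet_derivative (\<lambda>y. frechet_derivative f (at y) v) (at x) w) < \<epsilon>"
      unfolding eventually_at_right_field G_def[symmetric] using m
      by (metis (lifting) G_def)
  qed
qed

text \<open>The second difference is symmetric in \<open>v\<close> and \<open>w\<close>, so both
  mixed derivatives are limits of the same quotient.\<close>

lemma second_derivative_commute:
  fixes f :: "'a::euclidean_space \<Rightarrow> real"
  assumes "open S" "x \<in> S" "Ck_on 2 f S"
  shows "frechet_derivative (\<lambda>y. frechet_derivative f (at y) v) (at x) w =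
    frechet_derivative (\<lambda>y. frechet_derivative f (at y) w) (at x) v"
proof (rule tendsto_unique[OF trivial_limit_at_right_real second_difference_tendsto[OF assms]])
  show "((\<lambda>h. (f (x + h *\<^sub>R v + h *\<^sub>R w) - f (x + h *\<^sub>R v) - f (x + h *\<^sub>R w) + f x) / (h * h)) \<longlongrightarrow>
     frechet_derivative (\<lambda>y. frechet_derivative f (at y) w) (at x) v) (at_right 0)"
    using second_difference_tendsto[OF assms, of w v] by (simp add: algebra_simps)
qed

section \<open>Codazzi equations\<close>

text \<open>Traces are taken over the fixed ambient basis; this contraction evaluates them without a
  moving frame.\<close>

lemma sum_Basis_inner_linear:
  fixes f :: "'a::euclidean_space \<Rightarrow> 'b::real_inner"
  assumes "linear f"
  shows "(\<Sum>e\<in>Basis. (e \<bullet> a) * (f e \<bullet> b)) = f a \<bullet> b"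
proof -
  have "f a = f (\<Sum>e\<in>Basis. (a \<bullet> e) *\<^sub>R e)" by (simp add: euclidean_representation)
  also have "\<dots> = (\<Sum>e\<in>Basis. (a \<bullet> e) *\<^sub>R f e)"
    by (simp add: linear_sum[OF assms] linear_cmul[OF assms])
  finally show ?thesis by (simp add: inner_sum_left inner_commute[of a])
qed

section \<open>Linear algebra of an orthogonal complex structure\<close>

locale complex_structure =
  fixes J :: "'a::euclidean_space \<Rightarrow> 'a"
  assumes linear_J: "linear J"
    and J_J [simp]: "J (J v) = - v"
    and J_isometry: "J v \<bullet> J w = v \<bullet> w"
begin

lemma J_skew: "J v \<bullet> w = - (v \<bullet> J w)"
  using J_isometry[of v "J w"] by simp

lemma J_orthogonal [simp]: "J v \<bullet> v = 0" "v \<bullet> J v = 0"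
  using J_skew[of v v] by (simp_all add: inner_commute)

lemma J_linear_simps:
  "J (v + w) = J v + J w" "J (v - w) = J v - J w" "J (- v) = - J v" "J (c *\<^sub>R v) = c *\<^sub>R J v" "J 0 = 0"
  by (simp_all add: linear_add[OF linear_J] linear_diff[OF linear_J] linear_neg[OF linear_J]
      linear_cmul[OF linear_J] linear_0[OF linear_J])

lemma bounded_linear_J: "bounded_linear J"
  using linear_J by (simp add: linear_conv_bounded_linear)

text \<open>For a unit normal \<open>u\<close> this is the largest \<open>J\<close>-invariant
  subspace of the tangent space, the real picture of the holomorphic tangent space.\<close>

definition hor :: "'a \<Rightarrow> 'a set" where
  "hor u = {v. v \<bullet> u = 0 \<and> v \<bullet> J u = 0}"

definition hproj :: "'a \<Rightarrow> 'a \<Rightarrow> 'a" where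
  "hproj u v = v - (v \<bullet> u) *\<^sub>R u - (v \<bullet> J u) *\<^sub>R J u"

lemma linear_hproj: "linear (hproj u)"
  by (rule linearI) (auto simp: hproj_def algebra_simps)

lemma horD: "v \<in> hor u \<Longrightarrow> v \<bullet> u = 0" "v \<in> hor u \<Longrightarrow> v \<bullet> J u = 0"
    "v \<in> hor u \<Longrightarrow> u \<bullet> v = 0" "v \<in> hor u \<Longrightarrow> J u \<bullet> v = 0"
  by (auto simp: hor_def inner_commute)

lemma J_hor: "v \<in> hor u \<Longrightarrow> J v \<in> hor u"
  by (auto simp: hor_def J_isometry J_skew[of v u])

lemma hor_uminus: "v \<in> hor u \<Longrightarrow> - v \<in> hor u"
  by (auto simp: hor_def)

lemma hproj_hor: "v \<in> hor u \<Longrightarrow> hproj u v = v"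
  by (auto simp: hor_def hproj_def)

lemma hproj_in_hor: "norm u = 1 \<Longrightarrow> hproj u v \<in> hor u"
  by (auto simp: hor_def hproj_def algebra_simps J_isometry norm_eq_1)

lemma hproj_sym: "hproj u v \<bullet> w = v \<bullet> hproj u w"
  by (simp add: hproj_def algebra_simps inner_commute)

lemma hproj_inner_hor: "w \<in> hor u \<Longrightarrow> hproj u v \<bullet> w = v \<bullet> w"
  by (simp add: hproj_sym hproj_hor)

lemma hproj_J: "hproj u (J v) = J (hproj u v)"
  by (simp add: hproj_def J_linear_simps J_isometry J_skew[of v u] algebra_simps)

lemma hproj_self [simp]: "norm u = 1 \<Longrightarrow> hproj u u = 0" "norm u = 1 \<Longrightarrow> hproj u (J u) = 0"
  by (auto simp: hproj_def norm_eq_1 J_isometry)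

lemma hproj_decomp: "v = hproj u v + (v \<bullet> J u) *\<^sub>R J u" if "v \<bullet> u = 0"
  using that by (simp add: hproj_def)

end

text \<open>\<open>N\<close> is an open piece of the hypersurface, \<open>A\<close> the Hessian of a defining function whose gradient
  on \<open>N\<close> is the unit normal \<open>\<nu>\<close>, and \<open>t x X\<close> the derivative of \<open>A\<close> at \<open>x\<close> in the direction \<open>X\<close>, so
  that \<open>t x\<close> is totally symmetric: this is the Codazzi equation.  The assumption \<open>tang\<close> says that tangent
  vectors annihilate the functions that vanish on \<open>N\<close>.  On horizontal vectors, \<open>levi_inv\<close> is the vanishing of
  \<open>h(Z, W)\<close>, and \<open>\<tau>\<close> is the real trace of the Levi form.\<close>

locale levi_germ = complex_structure J for J :: "'a::euclidean_space \<Rightarrow> 'a" +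
  fixes N :: "'a set" and \<nu> :: "'a \<Rightarrow> 'a" and A :: "'a \<Rightarrow> 'a \<Rightarrow> 'a"
    and t :: "'a \<Rightarrow> 'a \<Rightarrow> 'a \<Rightarrow> 'a" and s \<tau> :: real
  assumes deriv_\<nu>: "x \<in> N \<Longrightarrow> (\<nu> has_derivative A x) (at x within N)"
    and deriv_A: "x \<in> N \<Longrightarrow> ((\<lambda>y. A y v) has_derivative (\<lambda>X. t x X v)) (at x within N)"
    and unit: "x \<in> N \<Longrightarrow> norm (\<nu> x) = 1"
    and A_sym: "x \<in> N \<Longrightarrow> A x v \<bullet> w = v \<bullet> A x w"
    and t_sym1: "x \<in> N \<Longrightarrow> t x X v \<bullet> w = t x v X \<bullet> w"
    and t_sym2: "x \<in> N \<Longrightarrow> t x X v \<bullet> w = t x X w \<bullet> v"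
    and tang: "(f has_derivative D) (at x within N) \<Longrightarrow> x \<in> N \<Longrightarrow> (\<forall>y\<in>N. f y = (c::real)) \<Longrightarrow>
      X \<bullet> \<nu> x = 0 \<Longrightarrow> D X = 0"
    and levi_inv: "x \<in> N \<Longrightarrow> v \<in> hor (\<nu> x) \<Longrightarrow> w \<in> hor (\<nu> x) \<Longrightarrow> A x (J v) \<bullet> J w = A x v \<bullet> w"
    and levi_sign: "x \<in> N \<Longrightarrow> v \<in> hor (\<nu> x) \<Longrightarrow> 0 \<le> s * (A x v \<bullet> v)"
    and levi_trace: "x \<in> N \<Longrightarrow> (\<Sum>e\<in>Basis. A x (hproj (\<nu> x) e) \<bullet> hproj (\<nu> x) e) = \<tau>"
    and trace_pos: "0 < s * \<tau>"
begin

section \<open>The Hessian and its derivative along the hypersurface\<close>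

lemma linear_A: "x \<in> N \<Longrightarrow> linear (A x)"
  using deriv_\<nu> has_derivative_linear by blast

lemma linear_t1: "x \<in> N \<Longrightarrow> linear (\<lambda>X. t x X v)"
  using deriv_A has_derivative_linear by blast

lemma t_commute:
  assumes "x \<in> N"
  shows "t x X v = t x v X"
proof -
  have "\<forall>z. t x X v \<bullet> z = t x v X \<bullet> z" using t_sym1[OF assms] by blast
  then show ?thesis by (simp only: vector_eq_rdot)
qed

lemma t_rotate:
  assumes "x \<in> N"
  shows "t x X v \<bullet> w = t x v w \<bullet> X" "t x X v \<bullet> w = t x w v \<bullet> X"
  by (rule trans[OF t_sym1[OF assms] t_sym2[OF assms]],
      rule trans[OF t_sym2[OF assms] trans[OF t_sym1[OF assms] t_sym2[OF assms]]])

lemma linear_t2: "x \<in> N \<Longrightarrow> linear (t x X)"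
  using linear_t1[of x X] t_commute[of x X] by (simp add: linear_iff)

lemma A_simps:
  assumes "x \<in> N"
  shows "A x (v + w) = A x v + A x w" "A x (v - w) = A x v - A x w" "A x (- v) = - A x v"
    "A x (c *\<^sub>R v) = c *\<^sub>R A x v" "A x 0 = 0"
  using linear_A[OF assms] by (simp_all add: linear_add linear_diff linear_neg linear_cmul linear_0)

lemma t_simps:
  assumes "x \<in> N"
  shows "t x X (v + w) = t x X v + t x X w" "t x X (v - w) = t x X v - t x X w" "t x X (- v) = - t x X v"
    "t x X (c *\<^sub>R v) = c *\<^sub>R t x X v"
    "t x (v + w) X = t x v X + t x w X" "t x (v - w) X = t x v X - t x w X" "t x (- v) X = - t x v X"
    "t x (c *\<^sub>R v) X = c *\<^sub>R t x v X"
  using linear_t2[OF assms] linear_add[OF linear_t1[OF assms]] linear_diff[OF linear_t1[OF assms]]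
    linear_neg[OF linear_t1[OF assms]] linear_cmul[OF linear_t1[OF assms]]
  by (simp_all add: linear_add linear_diff linear_neg linear_cmul)

lemma \<nu>_inner [simp]: "x \<in> N \<Longrightarrow> \<nu> x \<bullet> \<nu> x = 1" "x \<in> N \<Longrightarrow> J (\<nu> x) \<bullet> J (\<nu> x) = 1"
  using unit by (auto simp: norm_eq_1 J_isometry)

text \<open>This is the derivative of \<open>\<nu> \<bullet> \<nu> = 1\<close>. The second claim
  follows by symmetry of the Hessian and is what survives of \<open>A \<nu> = 0\<close> for a
  potential whose gradient has norm 1 on \<open>N\<close> only.\<close>

lemma A_tangent:
  assumes x: "x \<in> N" and X: "X \<bullet> \<nu> x = 0"
  shows "A x X \<bullet> \<nu> x = 0" "A x (\<nu> x) \<bullet> X = 0"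
proof -
  have "((\<lambda>y. \<nu> y \<bullet> \<nu> y) has_derivative (\<lambda>X. \<nu> x \<bullet> A x X + A x X \<bullet> \<nu> x)) (at x within N)"
    using x by (auto intro!: derivative_eq_intros deriv_\<nu>)
  from tang[OF this x _ X, of 1] show "A x X \<bullet> \<nu> x = 0" by (auto simp: inner_commute)
  then show "A x (\<nu> x) \<bullet> X = 0" by (metis A_sym[OF x] inner_commute)
qed

text \<open>\<open>deriv_A\<close> differentiates \<open>A\<close> at a fixed vector only, so the
  moving argument is expanded in the ambient basis.\<close>

lemma deriv_A_comp:
  assumes x: "x \<in> N" and Y: "(Y has_derivative Y') (at x within N)"
  shows "((\<lambda>y. A y (Y y)) has_derivative (\<lambda>X. t x X (Y x) + A x (Y' X))) (at x within N)"
proof -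
  have eq: "L v = (\<Sum>e\<in>Basis. (v \<bullet> e) *\<^sub>R L e)" if "linear L" for L :: "'a \<Rightarrow> 'a" and v
  proof -
    have "L v = L (\<Sum>e\<in>Basis. (v \<bullet> e) *\<^sub>R e)" by (simp add: euclidean_representation)
    then show ?thesis by (simp only: linear_sum[OF that] linear_cmul[OF that] o_def)
  qed
  have "((\<lambda>y. \<Sum>e\<in>Basis. (Y y \<bullet> e) *\<^sub>R A y e) has_derivative
      (\<lambda>X. \<Sum>e\<in>Basis. (Y x \<bullet> e) *\<^sub>R t x X e + (Y' X \<bullet> e) *\<^sub>R A x e)) (at x within N)"
    by (intro has_derivative_sum has_derivative_scaleR has_derivative_inner_left Y deriv_A x)
  then have "((\<lambda>y. \<Sum>e\<in>Basis. (Y y \<bullet> e) *\<^sub>R A y e) has_derivative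
      (\<lambda>X. t x X (Y x) + A x (Y' X))) (at x within N)"
    by (rule has_derivative_eq_rhs)
      (simp add: sum.distrib eq[OF linear_A[OF x], symmetric] eq[OF linear_t2[OF x], symmetric])
  then show ?thesis
    by (rule has_derivative_transform[OF x, rotated]) (use eq linear_A in blast)
qed

lemma deriv_A_inner:
  assumes "x \<in> N" "(Y has_derivative Y') (at x within N)" "(W has_derivative W') (at x within N)"
  shows "((\<lambda>y. A y (Y y) \<bullet> W y) has_derivative
    (\<lambda>X. t x X (Y x) \<bullet> W x + A x (Y' X) \<bullet> W x + A x (Y x) \<bullet> W' X)) (at x within N)"
  by (rule has_derivative_eq_rhs[OF has_derivative_inner[OF deriv_A_comp[OF assms(1,2)] assms(3)]])
    (auto simp: algebra_simps)

lemma deriv_J: "(Y has_derivative Y') F \<Longrightarrow> ((\<lambda>y. J (Y y)) has_derivative (\<lambda>X. J (Y' X))) F"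
  by (rule bounded_linear.has_derivative[OF bounded_linear_J])

lemma deriv_hproj:
  assumes "x \<in> N"
  shows "((\<lambda>y. hproj (\<nu> y) v) has_derivative
    (\<lambda>X. - ((v \<bullet> A x X) *\<^sub>R \<nu> x + (v \<bullet> \<nu> x) *\<^sub>R A x X
        + (v \<bullet> J (A x X)) *\<^sub>R J (\<nu> x) + (v \<bullet> J (\<nu> x)) *\<^sub>R J (A x X)))) (at x within N)"
  unfolding hproj_def
  by (rule has_derivative_eq_rhs, (rule derivative_intros deriv_\<nu> deriv_J assms)+) (auto simp: algebra_simps)

text \<open>Projecting the fixed vector \<open>v\<close> extends it to a horizontal field. At
  \<open>x\<close> its derivative has components along \<open>\<nu>\<close> and
  \<open>J \<nu>\<close> only, so horizontally the field is parallel there.\<close>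

lemma deriv_hproj_hor:
  assumes "x \<in> N" "v \<in> hor (\<nu> x)"
  shows "((\<lambda>y. hproj (\<nu> y) v) has_derivative
    (\<lambda>X. (A x X \<bullet> J v) *\<^sub>R J (\<nu> x) - (A x X \<bullet> v) *\<^sub>R \<nu> x)) (at x within N)"
proof -
  have "v \<bullet> J (A x z) = - (A x z \<bullet> J v)" "v \<bullet> A x z = A x z \<bullet> v" for z
    using J_skew[of v "A x z"] by (simp_all add: inner_commute)
  then show ?thesis
    by (intro has_derivative_eq_rhs[OF deriv_hproj[OF assms(1), of v]])
      (simp add: horD(1,2)[OF assms(2)] fun_eq_iff)
qed

lemma hproj_\<nu>_hor: "x \<in> N \<Longrightarrow> hproj (\<nu> x) v \<in> hor (\<nu> x)"
  by (simp add: hproj_in_hor unit)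

lemma A_\<nu>_hor [simp]: "x \<in> N \<Longrightarrow> w \<in> hor (\<nu> x) \<Longrightarrow> A x (\<nu> x) \<bullet> w = 0"
    "x \<in> N \<Longrightarrow> w \<in> hor (\<nu> x) \<Longrightarrow> A x w \<bullet> \<nu> x = 0"
    "x \<in> N \<Longrightarrow> A x (\<nu> x) \<bullet> J (\<nu> x) = 0" "x \<in> N \<Longrightarrow> A x (J (\<nu> x)) \<bullet> \<nu> x = 0"
  by (rule A_tangent; simp add: horD)+

text \<open>\<open>levi_inv\<close> is differentiated with both vectors extended by projection. The
  \<open>\<nu>\<close> components of their derivatives drop out, and the \<open>J \<nu>\<close>
  components produce the mixed term.\<close>

lemma levi_inv_deriv:
  assumes x: "x \<in> N" and X: "X \<bullet> \<nu> x = 0" and vw: "v \<in> hor (\<nu> x)" "w \<in> hor (\<nu> x)"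
  shows "t x X (J v) \<bullet> J w - t x X v \<bullet> w =
    (A x X \<bullet> v) * (A x (J (\<nu> x)) \<bullet> J w) + (A x X \<bullet> w) * (A x (J (\<nu> x)) \<bullet> J v)
    + (A x X \<bullet> J v) * (A x (J (\<nu> x)) \<bullet> w) + (A x X \<bullet> J w) * (A x (J (\<nu> x)) \<bullet> v)"
proof -
  note P = deriv_hproj_hor[OF x]
  note D = has_derivative_diff[OF deriv_A_inner[OF x deriv_J[OF P[OF vw(1)]] deriv_J[OF P[OF vw(2)]]]
      deriv_A_inner[OF x P[OF vw(1)] P[OF vw(2)]], unfolded hproj_hor[OF vw(1)] hproj_hor[OF vw(2)]]
  have 0: "\<forall>y\<in>N. A y (J (hproj (\<nu> y) v)) \<bullet> J (hproj (\<nu> y) w) - A y (hproj (\<nu> y) v) \<bullet> hproj (\<nu> y) w = 0"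
    using levi_inv hproj_\<nu>_hor by simp
  have sy: "A x v \<bullet> J (\<nu> x) = A x (J (\<nu> x)) \<bullet> v" "A x w \<bullet> J (\<nu> x) = A x (J (\<nu> x)) \<bullet> w"
      "A x (J v) \<bullet> J (\<nu> x) = A x (J (\<nu> x)) \<bullet> J v" "A x (J w) \<bullet> J (\<nu> x) = A x (J (\<nu> x)) \<bullet> J w"
    by (metis A_sym[OF x] inner_commute)+
  note z = A_\<nu>_hor(1,2)[OF x vw(1)] A_\<nu>_hor(1,2)[OF x vw(2)] A_\<nu>_hor(1,2)[OF x J_hor[OF vw(1)]] 
    A_\<nu>_hor(1,2)[OF x J_hor[OF vw(2)]]
  show ?thesis
    using tang[OF D x 0 X]
    unfolding J_linear_simps A_simps[OF x] inner_add_left inner_add_right inner_diff_left inner_diff_right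
      inner_minus_left inner_minus_right inner_scaleR_left inner_scaleR_right J_J sy z
    by (simp only: mult_minus_left mult_minus_right mult_zero_right)
qed

text \<open>Swapping pairs of arguments with \<open>J\<close> in two ways determines the symmetric cubic form.\<close>

lemma t_horizontal:
  assumes x: "x \<in> N" and hor: "u \<in> hor (\<nu> x)" "v \<in> hor (\<nu> x)" "w \<in> hor (\<nu> x)"
  shows "t x u v \<bullet> w = - ((A x u \<bullet> w) * (A x (J (\<nu> x)) \<bullet> J v) + (A x v \<bullet> w) * (A x (J (\<nu> x)) \<bullet> J u)
      + (A x u \<bullet> v) * (A x (J (\<nu> x)) \<bullet> J w))"
proof -
  note J = hor[THEN J_hor]
  have e1: "t x u (J v) \<bullet> J w - t x u v \<bullet> w =
    (A x u \<bullet> v) * (A x (J (\<nu> x)) \<bullet> J w) + (A x u \<bullet> w) * (A x (J (\<nu> x)) \<bullet> J v)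
    + (A x u \<bullet> J v) * (A x (J (\<nu> x)) \<bullet> w) + (A x u \<bullet> J w) * (A x (J (\<nu> x)) \<bullet> v)"
    by (rule levi_inv_deriv[OF x horD(1)[OF hor(1)] hor(2,3)])
  have e2: "t x w (J u) \<bullet> J v - t x w u \<bullet> v =
    (A x w \<bullet> u) * (A x (J (\<nu> x)) \<bullet> J v) + (A x w \<bullet> v) * (A x (J (\<nu> x)) \<bullet> J u)
    + (A x w \<bullet> J u) * (A x (J (\<nu> x)) \<bullet> v) + (A x w \<bullet> J v) * (A x (J (\<nu> x)) \<bullet> u)"
    by (rule levi_inv_deriv[OF x horD(1)[OF hor(3)] hor(1,2)])
  have e3: "t x (J v) (J u) \<bullet> J (J w) - t x (J v) u \<bullet> J w =
    (A x (J v) \<bullet> u) * (A x (J (\<nu> x)) \<bullet> J (J w)) + (A x (J v) \<bullet> J w) * (A x (J (\<nu> x)) \<bullet> J u)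
    + (A x (J v) \<bullet> J u) * (A x (J (\<nu> x)) \<bullet> J w) + (A x (J v) \<bullet> J (J w)) * (A x (J (\<nu> x)) \<bullet> u)"
    by (rule levi_inv_deriv[OF x horD(1)[OF J(2)] hor(1) J(3)])
  have s: "t x w (J u) \<bullet> J v = t x (J v) (J u) \<bullet> w" "t x w u \<bullet> v = t x u v \<bullet> w"
    "t x (J v) u \<bullet> J w = t x u (J v) \<bullet> J w"
    by (rule trans[OF t_sym2[OF x] trans[OF t_sym1[OF x] t_sym2[OF x]]]
        trans[OF t_sym1[OF x] t_sym2[OF x]] t_sym1[OF x])+
  have i: "A x (J v) \<bullet> J w = A x v \<bullet> w" "A x (J v) \<bullet> J u = A x v \<bullet> u" 
    using levi_inv x hor by auto
  have k: "A x a \<bullet> J b = - (A x (J a) \<bullet> b)" if "a \<in> hor (\<nu> x)" "b \<in> hor (\<nu> x)" for a b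
    using levi_inv[OF x that(1) J_hor[OF that(2)]] by simp
  have c: "A x a \<bullet> b = A x b \<bullet> a" for a b
    by (metis A_sym[OF x] inner_commute)
  have r: "A x u \<bullet> J v = - (A x (J u) \<bullet> v)" "A x u \<bullet> J w = - (A x (J u) \<bullet> w)"
    "A x (J v) \<bullet> u = - (A x (J u) \<bullet> v)" "A x w \<bullet> J u = A x (J u) \<bullet> w" "A x w \<bullet> J v = A x (J v) \<bullet> w"
    "A x w \<bullet> u = A x u \<bullet> w" "A x w \<bullet> v = A x v \<bullet> w" "A x v \<bullet> u = A x u \<bullet> v"
    by (rule k[OF hor(1,2)] k[OF hor(1,3)] trans[OF c k[OF hor(1,2)]] c)+
  \<comment> \<open>\<open>T\<close>, \<open>T1\<close> and \<open>T2\<close> stand for the cubic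
    form at \<open>(u, v, w)\<close>, \<open>(u, J v, J w)\<close> and \<open>(J u, J v, w)\<close>.
    The left sides add up to \<open>- 2 * T\<close>; on the right the products containing the mixed
    term without \<open>J\<close> cancel and the others occur twice.\<close>
  have "T = - (qb + rc + pd)" if "T1 - T = pd + qb + - pf + - qg" "T2 - T = qb + rc + qg + rh"
    "- T2 - T1 = - (- pf) + rc + pd + - rh" for T T1 T2 pd qb pf qg rc rh :: real
    using that by linarith
  from this[OF e1[unfolded s i J_J r inner_minus_right mult_minus_left mult_minus_right]
      e2[unfolded s i J_J r inner_minus_right mult_minus_left mult_minus_right]
      e3[unfolded s i J_J r inner_minus_right mult_minus_left mult_minus_right]]
  show ?thesis .
qed


section \<open>The trace of the Levi form and the mixed term\<close>

definition curv :: "'a \<Rightarrow> real" where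
  "curv x = A x (J (\<nu> x)) \<bullet> J (\<nu> x)"

text \<open>The derivative of the constant trace consists of the trace of \<open>t\<close>, known
  from \<open>t_horizontal\<close>, and the variation of the projections. Each contributes 2 to the
  factor 4.\<close>

lemma levi_trace_deriv:
  assumes x: "x \<in> N" and X: "X \<in> hor (\<nu> x)"
  shows "4 * (J (hproj (\<nu> x) (A x X)) \<bullet> A x (J (\<nu> x))) + \<tau> * (A x (J (\<nu> x)) \<bullet> J X) = 0"
proof -
  define P where "P = hproj (\<nu> x)"
  define a where "a = A x X"
  define T where "T = J (\<nu> x)"
  \<comment> \<open>The derivative of \<open>hproj (\<nu> y) e\<close> at \<open>x\<close> along
    \<open>X\<close>, as in \<open>deriv_hproj\<close>.\<close>
  define P' where "P' e = - ((e \<bullet> a) *\<^sub>R \<nu> x + (e \<bullet> \<nu> x) *\<^sub>R a + (e \<bullet> J a) *\<^sub>R T + (e \<bullet> T) *\<^sub>R J a)" for e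
  have lP: "linear P" unfolding P_def by (rule linear_hproj)
  have P: "P e \<in> hor (\<nu> x)" for e unfolding P_def using hproj_\<nu>_hor x by blast
  have D: "((\<lambda>y. \<Sum>e\<in>Basis. A y (hproj (\<nu> y) e) \<bullet> hproj (\<nu> y) e) has_derivative
    (\<lambda>X. \<Sum>e\<in>Basis. t x X (hproj (\<nu> x) e) \<bullet> hproj (\<nu> x) e
      + A x (- ((e \<bullet> A x X) *\<^sub>R \<nu> x + (e \<bullet> \<nu> x) *\<^sub>R A x X
        + (e \<bullet> J (A x X)) *\<^sub>R J (\<nu> x) + (e \<bullet> J (\<nu> x)) *\<^sub>R J (A x X))) \<bullet> hproj (\<nu> x) e
      + A x (hproj (\<nu> x) e) \<bullet> - ((e \<bullet> A x X) *\<^sub>R \<nu> x + (e \<bullet> \<nu> x) *\<^sub>R A x X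
        + (e \<bullet> J (A x X)) *\<^sub>R J (\<nu> x) + (e \<bullet> J (\<nu> x)) *\<^sub>R J (A x X)))) (at x within N)"
    by (intro has_derivative_sum deriv_A_inner deriv_hproj x)
  have "(\<Sum>e\<in>Basis. t x X (P e) \<bullet> P e + A x (P' e) \<bullet> P e + A x (P e) \<bullet> P' e) = 0"
    using tang[OF D x _ horD(1)[OF X], of \<tau>] levi_trace unfolding P'_def P_def a_def T_def by blast
  moreover have "A x (P e) \<bullet> P' e = A x (P' e) \<bullet> P e" for e
    by (metis A_sym[OF x] inner_commute)
  ultimately have 0: "(\<Sum>e\<in>Basis. t x X (P e) \<bullet> P e) + 2 * (\<Sum>e\<in>Basis. A x (P' e) \<bullet> P e) = 0"
    by (simp only: sum.distrib)
  have "A x (P' e) \<bullet> P e = - ((e \<bullet> \<nu> x) * (P e \<bullet> A x a) + (e \<bullet> J a) * (P e \<bullet> A x T) + (e \<bullet> T) * (P e \<bullet> A x (J a)))" for e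
    using A_\<nu>_hor(1)[OF x P[of e]] unfolding P'_def
    by (simp add: A_simps[OF x] inner_add_left inner_diff_left inner_commute[of "P e"])
  then have 1: "(\<Sum>e\<in>Basis. A x (P' e) \<bullet> P e) = - (P (\<nu> x) \<bullet> A x a + P (J a) \<bullet> A x T + P T \<bullet> A x (J a))"
    by (simp only: sum_negf sum.distrib sum_Basis_inner_linear[OF lP])
  have 2: "P (\<nu> x) = 0" "P T = 0" using unit[OF x] by (simp_all add: P_def T_def)
  have "t x X (P e) \<bullet> P e = - (2 * ((e \<bullet> P a) * (J (P e) \<bullet> A x T)) + (A x (P e) \<bullet> P e) * (A x T \<bullet> J X))" for e
  proof -
    have "A x X \<bullet> P e = e \<bullet> P a" unfolding a_def P_def by (metis hproj_sym inner_commute)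
    then show ?thesis
      unfolding t_horizontal[OF x X P P] T_def by (simp add: inner_commute[of "J (P e)"])
  qed
  then have "(\<Sum>e\<in>Basis. t x X (P e) \<bullet> P e) =
      - (2 * (\<Sum>e\<in>Basis. (e \<bullet> P a) * (J (P e) \<bullet> A x T)) + (\<Sum>e\<in>Basis. A x (P e) \<bullet> P e) * (A x T \<bullet> J X))"
    by (simp only: sum.distrib sum_negf sum_distrib_left sum_distrib_right)
  also have "(\<Sum>e\<in>Basis. A x (P e) \<bullet> P e) = \<tau>" unfolding P_def by (rule levi_trace[OF x])
  also have "(\<Sum>e\<in>Basis. (e \<bullet> P a) * (J (P e) \<bullet> A x T)) = J (P (P a)) \<bullet> A x T"
    using sum_Basis_inner_linear[OF linear_compose[OF lP linear_J]] by simp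
  also have "P (P a) = P a" using hproj_hor[OF P[of a]] by (simp add: P_def)
  finally have "(\<Sum>e\<in>Basis. t x X (P e) \<bullet> P e) = - (2 * (J (P a) \<bullet> A x T) + \<tau> * (A x T \<bullet> J X))" .
  moreover have "P (J a) = J (P a)" unfolding P_def by (rule hproj_J)
  ultimately show ?thesis using 0 1 2 unfolding P_def a_def T_def by simp
qed

lemma mixed_zero:
  assumes x: "x \<in> N" and w: "w \<in> hor (\<nu> x)"
  shows "A x (J (\<nu> x)) \<bullet> w = 0"
proof -
  define u where "u = hproj (\<nu> x) (A x (J (\<nu> x)))"
  have u: "u \<in> hor (\<nu> x)" unfolding u_def by (rule hproj_\<nu>_hor[OF x])
  have Au: "v \<bullet> A x (J (\<nu> x)) = v \<bullet> u" if "v \<in> hor (\<nu> x)" for v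
    unfolding u_def using hproj_inner_hor[OF that] by (simp add: inner_commute)
  \<comment> \<open>\<open>u\<close> represents the mixed term on horizontal vectors.
    Differentiating the trace along \<open>- J u\<close> gives \<open>J (- J u) = u\<close>, so the
    two terms become \<open>4 * (A x u \<bullet> u)\<close> and
    \<open>\<tau> * (u \<bullet> u)\<close>, which cannot have opposite signs.\<close>
  define p where "p = hproj (\<nu> x) (A x (- J u))"
  have p: "p \<in> hor (\<nu> x)" unfolding p_def by (rule hproj_\<nu>_hor[OF x])
  have "J p \<bullet> A x (J (\<nu> x)) = A x u \<bullet> u"
  proof -
    have "J p \<bullet> A x (J (\<nu> x)) = - (p \<bullet> J u)"
      unfolding Au[OF J_hor[OF p]] by (rule J_skew)
    also have "p \<bullet> J u = A x (- J u) \<bullet> J u"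
      unfolding p_def by (rule hproj_inner_hor[OF J_hor[OF u]])
    also have "\<dots> = - (A x u \<bullet> u)" by (simp add: A_simps[OF x] levi_inv[OF x u u])
    finally show ?thesis by simp
  qed
  moreover have "A x (J (\<nu> x)) \<bullet> J (- J u) = u \<bullet> u"
    using Au[OF u] by (simp add: J_linear_simps inner_commute)
  ultimately have "4 * (A x u \<bullet> u) + \<tau> * (u \<bullet> u) = 0"
    using levi_trace_deriv[OF x hor_uminus[OF J_hor[OF u]]] by (simp add: p_def)
  then have "4 * (s * (A x u \<bullet> u)) + s * \<tau> * (u \<bullet> u) = 0"
    by (metis distrib_left mult.assoc mult.left_commute mult_zero_right)
  then have "s * \<tau> * (u \<bullet> u) \<le> 0" using levi_sign[OF x u] by linarith
  then have "u \<bullet> u \<le> 0" using trace_pos mult_pos_pos[of "s * \<tau>" "u \<bullet> u"] by linarith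
  then have "u = 0" by (metis inner_gt_zero_iff not_le)
  then show ?thesis using Au[OF w] by (simp add: inner_commute)
qed

section \<open>Algebra of the shape operator on the tangent space\<close>

lemma A_hor: "A x v \<in> hor (\<nu> x)" if "x \<in> N" "v \<in> hor (\<nu> x)"
proof -
  have "A x v \<bullet> J (\<nu> x) = A x (J (\<nu> x)) \<bullet> v" by (metis A_sym[OF that(1)] inner_commute)
  then show ?thesis using that mixed_zero by (simp add: hor_def)
qed

text \<open>Now that \<open>A\<close> preserves the horizontal space, \<open>levi_inv\<close>
  becomes an operator identity without projections.\<close>

lemma A_J:
  assumes x: "x \<in> N" and v: "v \<in> hor (\<nu> x)"
  shows "A x (J v) = J (A x v)"
proof -
  define d where "d = A x (J v) - J (A x v)"
  have d: "d \<in> hor (\<nu> x)"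
    using A_hor[OF x J_hor[OF v]] J_hor[OF A_hor[OF x v]] by (simp add: d_def hor_def inner_diff_left)
  define w where "w = - J d"
  have w: "w \<in> hor (\<nu> x)" "J w = d"
    unfolding w_def using hor_uminus[OF J_hor[OF d]] by (auto simp: J_linear_simps)
  have "d \<bullet> d = A x (J v) \<bullet> J w - J (A x v) \<bullet> J w"
    by (simp add: w(2)) (simp add: d_def inner_diff_left)
  also have "\<dots> = 0" using levi_inv[OF x v w(1)] by (simp add: J_isometry)
  finally show ?thesis by (simp add: d_def)
qed

lemma A_JN:
  assumes x: "x \<in> N"
  shows "A x (J (\<nu> x)) = curv x *\<^sub>R J (\<nu> x)"
proof -
  define d where "d = A x (J (\<nu> x)) - curv x *\<^sub>R J (\<nu> x)"
  have d: "d \<in> hor (\<nu> x)"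
    using x by (simp add: d_def hor_def curv_def inner_diff_left)
  have "d \<bullet> d = A x (J (\<nu> x)) \<bullet> d - curv x * (J (\<nu> x) \<bullet> d)"
    by (simp add: d_def inner_diff_left)
  then show ?thesis using mixed_zero[OF x d] horD[OF d] by (simp add: d_def)
qed

text \<open>This is \<open>mixed_zero\<close> differentiated along \<open>X\<close>; the term with
  \<open>curv\<close> comes from the \<open>J \<nu>\<close> component of the derivative of the
  extended \<open>w\<close>.\<close>

lemma t_JN:
  assumes x: "x \<in> N" and X: "X \<bullet> \<nu> x = 0" and w: "w \<in> hor (\<nu> x)"
  shows "t x X (J (\<nu> x)) \<bullet> w = - (A x (J (A x X)) \<bullet> w) - curv x * (A x X \<bullet> J w)"
proof -
  note D = deriv_A_inner[OF x deriv_J[OF deriv_\<nu>[OF x]] deriv_hproj_hor[OF x w], unfolded hproj_hor[OF w]]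
  have "\<forall>y\<in>N. A y (J (\<nu> y)) \<bullet> hproj (\<nu> y) w = 0"
    by (intro ballI mixed_zero hproj_\<nu>_hor)
  from tang[OF D x this X]
  have "t x X (J (\<nu> x)) \<bullet> w + A x (J (A x X)) \<bullet> w
      + A x (J (\<nu> x)) \<bullet> ((A x X \<bullet> J w) *\<^sub>R J (\<nu> x) - (A x X \<bullet> w) *\<^sub>R \<nu> x) = 0" .
  moreover have "A x (J (\<nu> x)) \<bullet> ((A x X \<bullet> J w) *\<^sub>R J (\<nu> x) - (A x X \<bullet> w) *\<^sub>R \<nu> x) = curv x * (A x X \<bullet> J w)"
    using x by (simp add: inner_diff_right curv_def)
  ultimately show ?thesis by linarith
qed

text \<open>Two symmetries clash. With \<open>S = c A - A^2\<close>, \<open>t_JN\<close> identifies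
  the form \<open>t x v (J (\<nu> x)) \<bullet> w\<close> with \<open>J (S v) \<bullet> w\<close>,
  so Codazzi makes \<open>J S\<close> symmetric. But \<open>S\<close> is symmetric and commutes with
  the skew map \<open>J\<close>, so \<open>J S\<close> is also skew, hence zero.\<close>

lemma A_A_hor:
  assumes x: "x \<in> N" and X: "X \<in> hor (\<nu> x)"
  shows "A x (A x X) = curv x *\<^sub>R A x X"
proof -
  define S where "S v = curv x *\<^sub>R A x v - A x (A x v)" for v
  have S: "S v \<in> hor (\<nu> x)" if "v \<in> hor (\<nu> x)" for v
    using A_hor[OF x that] A_hor[OF x A_hor[OF x that]] by (simp add: S_def hor_def inner_diff_left)
  have SJ: "S (J v) = J (S v)" if "v \<in> hor (\<nu> x)" for v
    using A_J[OF x that] A_J[OF x A_hor[OF x that]] by (simp add: S_def J_linear_simps)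
  have S_sym: "S v \<bullet> w = v \<bullet> S w" for v w
    using A_sym[OF x, of v w] A_sym[OF x, of "A x v" w] A_sym[OF x, of v "A x w"]
    by (simp add: S_def inner_diff_left inner_diff_right)
  have tS: "t x v (J (\<nu> x)) \<bullet> w = J (S v) \<bullet> w" if "v \<in> hor (\<nu> x)" "w \<in> hor (\<nu> x)" for v w
  proof -
    have "A x v \<bullet> J w = - (J (A x v) \<bullet> w)" by (simp add: J_skew)
    then show ?thesis
      unfolding t_JN[OF x horD(1)[OF that(1)] that(2)]
      by (simp add: A_J[OF x A_hor[OF x that(1)]] S_def J_linear_simps inner_diff_left)
  qed
  define w where "w = J (S X)"
  have w: "w \<in> hor (\<nu> x)" unfolding w_def by (intro J_hor S X)
  have "J (S X) \<bullet> w = t x X (J (\<nu> x)) \<bullet> w" using tS X w by simp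
  also have "\<dots> = t x w (J (\<nu> x)) \<bullet> X" by (rule t_rotate(2)[OF x])
  also have "\<dots> = J (S w) \<bullet> X" using tS X w by simp
  also have "\<dots> = - (w \<bullet> J (S X))" by (simp add: J_skew S_sym SJ X)
  finally have "w \<bullet> w = 0" by (simp add: w_def)
  then have "J (J (S X)) = 0" by (simp add: w_def J_linear_simps)
  then show ?thesis by (simp add: S_def)
qed

lemma A_A_tangent:
  assumes x: "x \<in> N" and X: "X \<bullet> \<nu> x = 0"
  shows "A x (A x X) = curv x *\<^sub>R A x X"
  by (subst (1 2) hproj_decomp[OF X])
    (simp add: A_simps[OF x] A_A_hor[OF x hproj_\<nu>_hor[OF x]] A_JN[OF x] algebra_simps)

lemma t_JN_hor:
  assumes x: "x \<in> N" and X: "X \<bullet> \<nu> x = 0" and w: "w \<in> hor (\<nu> x)"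
  shows "t x X (J (\<nu> x)) \<bullet> w = 0"
proof -
  define Y where "Y = hproj (\<nu> x) X"
  define k where "k = X \<bullet> J (\<nu> x)"
  have Y: "Y \<in> hor (\<nu> x)" unfolding Y_def by (rule hproj_\<nu>_hor[OF x])
  have XY: "X = Y + k *\<^sub>R J (\<nu> x)" unfolding Y_def k_def by (rule hproj_decomp[OF X])
  have "t x Y (J (\<nu> x)) \<bullet> w = 0"
    using t_JN[OF x horD(1)[OF Y] w] J_skew[of "A x Y" w]
    by (simp add: A_J[OF x A_hor[OF x Y]] A_A_hor[OF x Y] J_linear_simps)
  moreover have "t x (J (\<nu> x)) (J (\<nu> x)) \<bullet> w = 0"
    using t_JN[OF x _ w, of "J (\<nu> x)"] x w J_hor[OF w]
    by (simp add: A_JN[OF x] J_linear_simps A_simps[OF x] horD)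
  ultimately show ?thesis unfolding XY by (simp add: t_simps[OF x] inner_add_left)
qed

section \<open>Constancy of the curvature in the direction \<open>J \<nu>\<close> and parallelism of
  the second fundamental form\<close>

lemma curv_deriv:
  assumes "x \<in> N"
  shows "(curv has_derivative
    (\<lambda>X. t x X (J (\<nu> x)) \<bullet> J (\<nu> x) + 2 * (A x (J (\<nu> x)) \<bullet> J (A x X)))) (at x within N)"
proof -
  have "A x (J (A x X)) \<bullet> J (\<nu> x) = A x (J (\<nu> x)) \<bullet> J (A x X)" for X
    by (metis A_sym[OF assms] inner_commute)
  then show ?thesis
    unfolding curv_def[abs_def]
    by (intro has_derivative_eq_rhs[OF deriv_A_inner[OF assms deriv_J[OF deriv_\<nu>[OF assms]] deriv_J[OF deriv_\<nu>[OF assms]]]])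
      (simp add: fun_eq_iff)
qed

lemma ex_levi_nonzero: "x \<in> N \<Longrightarrow> \<exists>v\<in>hor (\<nu> x). A x v \<bullet> v \<noteq> 0"
proof (rule ccontr)
  assume x: "x \<in> N" and "\<not> (\<exists>v\<in>hor (\<nu> x). A x v \<bullet> v \<noteq> 0)"
  then have "\<tau> = 0" using levi_trace[OF x] hproj_\<nu>_hor[OF x] by simp
  then show False using trace_pos by simp
qed

text \<open>Otherwise \<open>A^2 = 0\<close> on horizontal vectors, so \<open>A = 0\<close> there by
  symmetry, contrary to the non-zero trace.\<close>

lemma curv_nonzero: "x \<in> N \<Longrightarrow> curv x \<noteq> 0"
proof
  assume x: "x \<in> N" and 0: "curv x = 0"
  obtain v where v: "v \<in> hor (\<nu> x)" "A x v \<bullet> v \<noteq> 0" using ex_levi_nonzero[OF x] by blast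
  have "A x v \<bullet> A x v = A x (A x v) \<bullet> v" by (metis A_sym[OF x] inner_commute)
  then show False using A_A_hor[OF x v(1)] 0 v(2) by simp
qed

text \<open>The derivative of \<open>c\<close> in the direction \<open>J \<nu>\<close> is read off \<open>A\<^sup>2 = c A\<close>, since in that
  direction the derivative of the horizontal part of \<open>A\<close> vanishes.\<close>

lemma curv_deriv_zero:
  assumes x: "x \<in> N" and X: "X \<bullet> \<nu> x = 0"
  shows "t x X (J (\<nu> x)) \<bullet> J (\<nu> x) + 2 * (A x (J (\<nu> x)) \<bullet> J (A x X)) = 0"
proof -
  define dc where "dc X = t x X (J (\<nu> x)) \<bullet> J (\<nu> x) + 2 * (A x (J (\<nu> x)) \<bullet> J (A x X))" for X
  define Y where "Y = hproj (\<nu> x) X"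
  define k where "k = X \<bullet> J (\<nu> x)"
  have Y: "Y \<in> hor (\<nu> x)" unfolding Y_def by (rule hproj_\<nu>_hor[OF x])
  have XY: "X = Y + k *\<^sub>R J (\<nu> x)" unfolding Y_def k_def by (rule hproj_decomp[OF X])
  have "linear dc"
    using has_derivative_linear[OF curv_deriv[OF x]] by (simp add: dc_def[abs_def])
  then have dcX: "dc X = dc Y + k * dc (J (\<nu> x))"
    unfolding XY by (simp add: linear_add linear_cmul)
  \<comment> \<open>Codazzi moves the horizontal vector \<open>Y\<close> into the last slot, where
    \<open>t_JN_hor\<close> applies; the correction term in \<open>dc\<close> is an instance of the
    mixed term.\<close>
  have "t x Y (J (\<nu> x)) \<bullet> J (\<nu> x) = t x (J (\<nu> x)) (J (\<nu> x)) \<bullet> Y"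
    by (rule t_rotate(1)[OF x])
  then have 1: "dc Y = 0"
    using t_JN_hor[OF x _ Y, of "J (\<nu> x)"] mixed_zero[OF x J_hor[OF A_hor[OF x Y]]] by (simp add: dc_def)
  obtain v where v: "v \<in> hor (\<nu> x)" "A x v \<bullet> v \<noteq> 0" using ex_levi_nonzero[OF x] by blast
  note P = deriv_hproj_hor[OF x v(1)]
  note AP = deriv_A_comp[OF x P]
  note D = has_derivative_diff[OF has_derivative_inner[OF AP AP]
      has_derivative_mult[OF curv_deriv[OF x] deriv_A_inner[OF x P P]], unfolded hproj_hor[OF v(1)]]
  \<comment> \<open>A scalar consequence of \<open>A^2 = c A\<close> suffices. Testing on
    \<open>v\<close> with \<open>A x v \<bullet> v \<noteq> 0\<close> leaves an invertible factor in
    front of the derivative of \<open>c\<close>.\<close>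
  have 0: "\<forall>y\<in>N. A y (hproj (\<nu> y) v) \<bullet> A y (hproj (\<nu> y) v)
      - curv y * (A y (hproj (\<nu> y) v) \<bullet> hproj (\<nu> y) v) = 0"
  proof
    fix y assume y: "y \<in> N"
    let ?w = "hproj (\<nu> y) v"
    have "A y ?w \<bullet> A y ?w = A y (A y ?w) \<bullet> ?w" by (metis A_sym[OF y] inner_commute)
    then show "A y ?w \<bullet> A y ?w - curv y * (A y ?w \<bullet> ?w) = 0"
      by (simp add: A_A_hor[OF y hproj_\<nu>_hor[OF y]])
  qed
  have tw: "t x (J (\<nu> x)) v \<bullet> w = 0" if "w \<in> hor (\<nu> x)" for w
    using t_JN_hor[OF x horD(1)[OF v(1)] that] by (simp add: t_commute[OF x])
  have P0: "(A x (J (\<nu> x)) \<bullet> J v) *\<^sub>R J (\<nu> x) - (A x (J (\<nu> x)) \<bullet> v) *\<^sub>R \<nu> x = 0"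
    using mixed_zero[OF x v(1)] mixed_zero[OF x J_hor[OF v(1)]] by simp
  have "dc (J (\<nu> x)) * (A x v \<bullet> v) = 0"
    using tang[OF D x 0, of "J (\<nu> x)"] tw[OF A_hor[OF x v(1)]] tw[OF v(1)]
    unfolding P0 by (simp add: A_simps[OF x] dc_def inner_commute[of "A x v" "t x (J (\<nu> x)) v"])
  then have "dc (J (\<nu> x)) = 0" using v(2) by simp
  then show ?thesis using 1 dcX by (simp add: dc_def)
qed

text \<open>Components are sorted by the occurrences of \<open>J \<nu>\<close>. Without any,
  \<open>t_horizontal\<close> applies with zero mixed term; with exactly one,
  \<open>t_JN_hor\<close>; those with at least two vanish because \<open>c\<close> has zero
  derivative.\<close>

lemma t_tangent_zero:
  assumes x: "x \<in> N" and tan: "X \<bullet> \<nu> x = 0" "Y \<bullet> \<nu> x = 0" "Z \<bullet> \<nu> x = 0"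
  shows "t x X Y \<bullet> Z = 0"
proof -
  have JNJN: "t x W (J (\<nu> x)) \<bullet> J (\<nu> x) = 0" if "W \<bullet> \<nu> x = 0" for W
  proof -
    define V where "V = hproj (\<nu> x) W"
    define k where "k = W \<bullet> J (\<nu> x)"
    have V: "V \<in> hor (\<nu> x)" unfolding V_def by (rule hproj_\<nu>_hor[OF x])
    have WV: "W = V + k *\<^sub>R J (\<nu> x)" unfolding V_def k_def by (rule hproj_decomp[OF that])
    have "A x (J (\<nu> x)) \<bullet> J (A x W) = 0"
      unfolding WV using mixed_zero[OF x J_hor[OF A_hor[OF x V]]] x
      by (simp add: A_simps[OF x] A_JN[OF x] J_linear_simps inner_add_right inner_diff_right)
    then show ?thesis using curv_deriv_zero[OF x that] by simp
  qed
  have JN: "t x W (J (\<nu> x)) \<bullet> U = 0" if "W \<bullet> \<nu> x = 0" "U \<bullet> \<nu> x = 0" for W U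
    by (subst hproj_decomp[OF that(2)])
      (simp add: inner_add_right t_JN_hor[OF x that(1) hproj_\<nu>_hor[OF x]] JNJN[OF that(1)])
  have hor: "t x U V \<bullet> W = 0" if "U \<in> hor (\<nu> x)" "V \<in> hor (\<nu> x)" "W \<in> hor (\<nu> x)" for U V W
    using t_horizontal[OF x that] mixed_zero[OF x J_hor] that by simp
  have "t x U V \<bullet> Z = 0" if "U \<in> hor (\<nu> x)" "V \<in> hor (\<nu> x)" for U V
  proof -
    have "t x U V \<bullet> J (\<nu> x) = 0" using JN[OF horD(1)[OF that(1)] horD(1)[OF that(2)]] t_sym2[OF x, of U V] by simp
    then show ?thesis
      by (subst hproj_decomp[OF tan(3)]) (simp add: inner_add_right hor[OF that hproj_\<nu>_hor[OF x]])
  qed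
  then have "t x U Y \<bullet> Z = 0" if "U \<in> hor (\<nu> x)" for U
    by (subst hproj_decomp[OF tan(2)])
      (simp add: t_simps[OF x] inner_add_left JN[OF horD(1)[OF that] tan(3)] that hproj_\<nu>_hor[OF x])
  moreover have "t x (J (\<nu> x)) Y \<bullet> Z = 0"
    using JN[OF tan(2,3)] by (simp add: t_commute[OF x, of "J (\<nu> x)"])
  ultimately show ?thesis
    by (subst hproj_decomp[OF tan(1)]) (simp add: t_simps[OF x] inner_add_left hproj_\<nu>_hor[OF x])
qed

text \<open>If \<open>k\<close> is the value of \<open>curv\<close> at \<open>x\<close>, then
  \<open>A x\<close> divided by \<open>k\<close> is idempotent on tangent vectors by
  \<open>A_A_tangent\<close>, and this is the orthogonal projection onto the kernel of
  \<open>A x\<close> in the tangent space. Applying \<open>A x\<close> to tangent vectors only makes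
  it independent of the potential.\<close>

definition kerproj :: "real \<Rightarrow> 'a \<Rightarrow> 'a \<Rightarrow> 'a" where
  "kerproj k x v = (v - (v \<bullet> \<nu> x) *\<^sub>R \<nu> x) - (1 / k) *\<^sub>R A x (v - (v \<bullet> \<nu> x) *\<^sub>R \<nu> x)"

lemma kerproj_deriv:
  assumes k: "\<And>y. y \<in> N \<Longrightarrow> curv y = k" and x: "x \<in> N"
  obtains D where "((\<lambda>y. kerproj k y v) has_derivative D) (at x within N)"
    "\<And>X. X \<bullet> \<nu> x = 0 \<Longrightarrow> D X = 0"
proof -
  define Q where "Q = (\<lambda>y. v - (v \<bullet> \<nu> y) *\<^sub>R \<nu> y)"
  define Q' where "Q' = (\<lambda>X. - ((v \<bullet> A x X) *\<^sub>R \<nu> x + (v \<bullet> \<nu> x) *\<^sub>R A x X))"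
  define D where "D X = Q' X - (1 / k) *\<^sub>R (t x X (Q x) + A x (Q' X))" for X
  have k0: "k \<noteq> 0" using curv_nonzero[OF x] k[OF x] by simp
  have Q: "(Q has_derivative Q') (at x within N)"
    unfolding Q_def Q'_def
    by (rule has_derivative_eq_rhs, (rule derivative_intros deriv_\<nu> x)+) (auto simp: algebra_simps)
  have Qt: "Q y \<bullet> \<nu> y = 0" if "y \<in> N" for y using that by (simp add: Q_def inner_diff_left)
  have D: "((\<lambda>y. kerproj k y v) has_derivative D) (at x within N)"
    unfolding kerproj_def D_def[abs_def] Q_def[symmetric]
    using has_derivative_diff[OF Q has_derivative_scaleR_right[OF deriv_A_comp[OF x Q], of "1 / k"]]
    by (simp add: Q_def)
  have "D X = 0" if X: "X \<bullet> \<nu> x = 0" for X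
  proof -
    define a where "a = A x X"
    have Aa: "A x a = k *\<^sub>R a" using A_A_tangent[OF x X] k[OF x] by (simp add: a_def)
    have a\<nu>: "a \<bullet> \<nu> x = 0" unfolding a_def by (rule A_tangent[OF x X])
    have tanw: "D X \<bullet> w = 0" if w: "w \<bullet> \<nu> x = 0" for w
    proof -
      \<comment> \<open>\<open>Q' X\<close> is a combination of \<open>\<nu> x\<close>, whose image
        under \<open>A x\<close> has no tangential part, and of \<open>a\<close>, an eigenvector for
        \<open>k\<close>.\<close>
      have "A x (Q' X) \<bullet> w = k * (Q' X \<bullet> w)"
        using A_tangent(2)[OF x w] w unfolding Q'_def a_def[symmetric]
        by (simp add: A_simps[OF x] Aa inner_add_left inner_commute[of "\<nu> x" w] inner_diff_left)
      then show ?thesis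
        using t_tangent_zero[OF x X Qt[OF x] w] k0 by (simp add: D_def inner_diff_left inner_add_left)
    qed
    \<comment> \<open>\<open>t_tangent_zero\<close> does not reach the normal component, which is
      read off the derivative of \<open>A y (Q y) \<bullet> \<nu> y = 0\<close>.\<close>
    have "t x X (Q x) \<bullet> \<nu> x + A x (Q' X) \<bullet> \<nu> x + A x (Q x) \<bullet> a = 0"
      using tang[OF deriv_A_inner[OF x Q deriv_\<nu>[OF x]] x _ X, of 0] A_tangent(1) Qt unfolding a_def by blast
    moreover have "A x (Q x) \<bullet> a = k * (v \<bullet> a)"
      using A_sym[OF x, of "Q x" a] a\<nu> by (simp add: Aa Q_def inner_diff_left inner_commute[of "\<nu> x" a])
    moreover have "Q' X \<bullet> \<nu> x = - (v \<bullet> a)"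
      using a\<nu> x unfolding Q'_def a_def[symmetric] by (simp add: inner_add_left inner_diff_left)
    moreover have "D X \<bullet> \<nu> x = Q' X \<bullet> \<nu> x - (1 / k) * (t x X (Q x) \<bullet> \<nu> x + A x (Q' X) \<bullet> \<nu> x)"
      by (simp add: D_def inner_diff_left inner_add_left)
    moreover have "t x X (Q x) \<bullet> \<nu> x + A x (Q' X) \<bullet> \<nu> x = - (k * (v \<bullet> a))"
      using calculation by linarith
    ultimately have n: "D X \<bullet> \<nu> x = 0" using k0 by simp
    then have "D X \<bullet> D X = 0" by (rule tanw)
    then show ?thesis by simp
  qed
  with D show thesis using that by blast
qed

text \<open>\<open>J \<nu>\<close> is an eigenvector for \<open>k\<close>, so its contributions
  cancel. The kernel is thus horizontal, and \<open>A_J\<close> shows that the projection commutes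
  with \<open>J\<close>.\<close>

lemma kerproj_hproj:
  assumes x: "x \<in> N" and k: "curv x = k"
  shows "kerproj k x v = hproj (\<nu> x) v - (1 / k) *\<^sub>R A x (hproj (\<nu> x) v)"
proof -
  have "k \<noteq> 0" using curv_nonzero[OF x] k by simp
  moreover have "v - (v \<bullet> \<nu> x) *\<^sub>R \<nu> x = hproj (\<nu> x) v + (v \<bullet> J (\<nu> x)) *\<^sub>R J (\<nu> x)"
    by (simp add: hproj_def)
  ultimately show ?thesis
    unfolding kerproj_def by (simp only:) (simp add: A_simps[OF x] A_JN[OF x] k scaleR_add_right)
qed

lemma kerproj_props:
  assumes x: "x \<in> N" and k: "curv x = k"
  shows "linear (kerproj k x)" "kerproj k x (kerproj k x v) = kerproj k x v"
    "kerproj k x v \<bullet> w = v \<bullet> kerproj k x w" "kerproj k x (J v) = J (kerproj k x v)"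
    "kerproj k x (\<nu> x) = 0" "X \<bullet> \<nu> x = 0 \<Longrightarrow> kerproj k x X = X - (1 / k) *\<^sub>R A x X"
    "\<exists>w\<in>hor (\<nu> x). w \<noteq> 0 \<and> kerproj k x w = 0"
proof -
  have k0: "k \<noteq> 0" using curv_nonzero[OF x] k by simp
  note H = kerproj_hproj[OF x k] and P = hproj_\<nu>_hor[OF x]
  show "linear (kerproj k x)"
    unfolding H[abs_def]
    by (intro linear_compose_sub linear_hproj linear_compose_scale_right
        linear_compose[OF linear_hproj linear_A[OF x], unfolded o_def])
  have "kerproj k x v \<in> hor (\<nu> x)" for v
    using A_hor[OF x P] P by (simp add: H hor_def inner_diff_left)
  then have "hproj (\<nu> x) (kerproj k x v) = kerproj k x v" for v by (rule hproj_hor)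
  then show "kerproj k x (kerproj k x v) = kerproj k x v"
    using k0 by (simp add: H A_simps[OF x] A_A_hor[OF x P] k)
  show "kerproj k x v \<bullet> w = v \<bullet> kerproj k x w"
  proof -
    have AP: "hproj (\<nu> x) (A x (hproj (\<nu> x) u)) = A x (hproj (\<nu> x) u)" for u
      by (rule hproj_hor[OF A_hor[OF x P]])
    have "A x (hproj (\<nu> x) v) \<bullet> w = v \<bullet> A x (hproj (\<nu> x) w)"
      by (metis AP hproj_sym A_sym[OF x])
    then show ?thesis by (simp add: H inner_diff_left inner_diff_right hproj_sym)
  qed
  show "kerproj k x (J v) = J (kerproj k x v)"
    by (simp add: H hproj_J A_J[OF x P] J_linear_simps)
  show "kerproj k x (\<nu> x) = 0"
    using unit[OF x] by (simp add: H A_simps[OF x])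
  show "X \<bullet> \<nu> x = 0 \<Longrightarrow> kerproj k x X = X - (1 / k) *\<^sub>R A x X"
    by (simp add: kerproj_def)
  \<comment> \<open>A vector in the image of \<open>A\<close> is killed by the projection. Next to
    \<open>\<nu>\<close> it is the second complex direction in the complement of the kernel, which
    later gives \<open>m \<le> n\<close>.\<close>
  obtain v where v: "v \<in> hor (\<nu> x)" "A x v \<bullet> v \<noteq> 0" using ex_levi_nonzero[OF x] by blast
  have "A x v \<in> hor (\<nu> x)" "A x v \<noteq> 0" "kerproj k x (A x v) = 0"
    using A_hor[OF x v(1)] v k0 by (auto simp: H hproj_hor A_A_hor[OF x v(1)] k)
  then show "\<exists>w\<in>hor (\<nu> x). w \<noteq> 0 \<and> kerproj k x w = 0" by blast
qed

end

section \<open>Tangential calculus on a hypersurface\<close>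

definition grad :: "('a::euclidean_space \<Rightarrow> real) \<Rightarrow> 'a \<Rightarrow> 'a" where
  "grad \<phi> x = (\<Sum>e\<in>Basis. frechet_derivative \<phi> (at x) e *\<^sub>R e)"

lemma has_derivative_grad:
  assumes "Ck_on (Suc k) \<phi> V" "x \<in> V"
  shows "(\<phi> has_derivative (\<lambda>v. grad \<phi> x \<bullet> v)) (at x)"
proof -
  note D = Ck_on_SucD[OF assms]
  have l: "linear (frechet_derivative \<phi> (at x))" using D by (rule has_derivative_linear)
  have "frechet_derivative \<phi> (at x) v = grad \<phi> x \<bullet> v" for v
  proof -
    have "frechet_derivative \<phi> (at x) v = frechet_derivative \<phi> (at x) (\<Sum>e\<in>Basis. (v \<bullet> e) *\<^sub>R e)"
      by (simp add: euclidean_representation)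
    also have "\<dots> = grad \<phi> x \<bullet> v"
      by (simp add: linear_sum[OF l] linear_cmul[OF l] grad_def inner_sum_left inner_commute[of v] mult.commute)
    finally show ?thesis .
  qed
  then have "frechet_derivative \<phi> (at x) = (\<lambda>v. grad \<phi> x \<bullet> v)" by blast
  with D show ?thesis by simp
qed

lemma frechet_derivative_eq_grad:
  assumes "Ck_on (Suc k) \<phi> V" "x \<in> V"
  shows "frechet_derivative \<phi> (at x) v = grad \<phi> x \<bullet> v"
  using frechet_derivative_at[OF has_derivative_grad[OF assms]] by metis

lemma Ck_on_grad:
  assumes "open V" "Ck_on (Suc k) \<phi> V"
  shows "Ck_on k (grad \<phi>) V"
proof -
  have "Ck_on k (\<lambda>x. \<Sum>e\<in>Basis. frechet_derivative \<phi> (at x) e *\<^sub>R e) V"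
    using assms by (intro Ck_on_sum Ck_on_bounded_linear[where L = "\<lambda>c. c *\<^sub>R _"] bounded_linear_scaleR_left) auto
  then show ?thesis by (simp add: grad_def[abs_def])
qed

text \<open>The first symmetry of \<open>t\<close> interchanges the two outer derivatives of
  \<open>\<phi>1 w\<close>; the second differentiates the symmetry of the Hessian.\<close>

lemma hessian_exists:
  fixes \<phi> :: "'a::euclidean_space \<Rightarrow> real"
  assumes V: "open V" and \<phi>: "\<And>k. Ck_on k \<phi> V"
  obtains A t where
    "\<And>x. x \<in> V \<Longrightarrow> (grad \<phi> has_derivative A x) (at x)"
    "\<And>x v. x \<in> V \<Longrightarrow> ((\<lambda>y. A y v) has_derivative (\<lambda>X. t x X v)) (at x)"
    "\<And>x v w. x \<in> V \<Longrightarrow> A x v \<bullet> w = v \<bullet> A x w"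
    "\<And>x X v w. x \<in> V \<Longrightarrow> t x X v \<bullet> w = t x v X \<bullet> w"
    "\<And>x X v w. x \<in> V \<Longrightarrow> t x X v \<bullet> w = t x X w \<bullet> v"
proof -
  define A where "A x = frechet_derivative (grad \<phi>) (at x)" for x
  define t where "t x X v = frechet_derivative (\<lambda>y. A y v) (at x) X" for x X v
  define \<phi>1 where "\<phi>1 w y = frechet_derivative \<phi> (at y) w" for w y
  define \<phi>2 where "\<phi>2 v w y = frechet_derivative (\<phi>1 w) (at y) v" for v w y
  have G: "Ck_on k (grad \<phi>) V" for k using Ck_on_grad[OF V \<phi>] .
  have C1: "Ck_on k (\<phi>1 w) V" for k w
    using \<phi>[of "Suc k"] by (simp add: \<phi>1_def[abs_def])
  have C2: "Ck_on k (\<phi>2 v w) V" for k v w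
    using C1[of "Suc k"] by (simp add: \<phi>2_def[abs_def])
  have \<phi>1: "\<phi>1 w y = grad \<phi> y \<bullet> w" if "y \<in> V" for w y
    unfolding \<phi>1_def by (rule frechet_derivative_eq_grad[OF \<phi> that])
  have dG: "(grad \<phi> has_derivative A x) (at x)" if "x \<in> V" for x
    unfolding A_def using G that by (rule Ck_on_SucD)
  have A2: "A x v \<bullet> w = \<phi>2 v w x" if x: "x \<in> V" for x v w
  proof -
    have "((\<lambda>y. grad \<phi> y \<bullet> w) has_derivative (\<lambda>v. A x v \<bullet> w)) (at x)"
      by (rule has_derivative_inner_left[OF dG[OF x]])
    then have "(\<phi>1 w has_derivative (\<lambda>v. A x v \<bullet> w)) (at x)"
      by (rule has_derivative_transform_within_open[OF _ V x]) (simp add: \<phi>1)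
    then show ?thesis unfolding \<phi>2_def by (metis frechet_derivative_at)
  qed
  have CA: "Ck_on k (\<lambda>y. A y v) V" for k v
    using G[of "Suc k"] by (simp add: A_def)
  have dA: "((\<lambda>y. A y v) has_derivative (\<lambda>X. t x X v)) (at x)" if "x \<in> V" for x v
    unfolding t_def using CA that by (rule Ck_on_SucD)
  have t3: "t x X v \<bullet> w = frechet_derivative (\<phi>2 v w) (at x) X" if x: "x \<in> V" for x X v w
  proof -
    have "((\<lambda>y. A y v \<bullet> w) has_derivative (\<lambda>X. t x X v \<bullet> w)) (at x)"
      by (rule has_derivative_inner_left[OF dA[OF x]])
    then have "(\<phi>2 v w has_derivative (\<lambda>X. t x X v \<bullet> w)) (at x)"
      by (rule has_derivative_transform_within_open[OF _ V x]) (simp add: A2)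
    then show ?thesis by (metis frechet_derivative_at)
  qed
  have sym2: "\<phi>2 v w x = \<phi>2 w v x" if "x \<in> V" for v w x
    unfolding \<phi>2_def \<phi>1_def by (rule second_derivative_commute[OF V that \<phi>])
  show thesis
  proof (rule that[of A t])
    show "A x v \<bullet> w = v \<bullet> A x w" if "x \<in> V" for x v w
      using A2[OF that, of v w] A2[OF that, of w v] sym2[OF that] by (simp add: inner_commute)
    show "t x X v \<bullet> w = t x v X \<bullet> w" if "x \<in> V" for x X v w
      unfolding t3[OF that] \<phi>2_def by (rule second_derivative_commute[OF V that C1])
    show "t x X v \<bullet> w = t x X w \<bullet> v" if x: "x \<in> V" for x X v w
    proof -
      have "(\<phi>2 v w has_derivative frechet_derivative (\<phi>2 v w) (at x)) (at x)"
        using C2 x by (rule Ck_on_SucD)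
      then have "(\<phi>2 w v has_derivative frechet_derivative (\<phi>2 v w) (at x)) (at x)"
        by (rule has_derivative_transform_within_open[OF _ V x]) (simp add: sym2)
      then show ?thesis unfolding t3[OF x] by (metis frechet_derivative_at)
    qed
  qed (use dG dA in auto)
qed

lemma unit_normal_parallel_grad:
  assumes nf: "unit_normal_field M \<nu>" and ld: "local_defining_function M V \<rho>" and x: "x \<in> M \<inter> V"
  shows "grad \<rho> x = (\<nu> x \<bullet> grad \<rho> x) *\<^sub>R \<nu> x" "\<nu> x \<bullet> grad \<rho> x \<noteq> 0"
proof -
  define n where "n = grad \<rho> x"
  have C: "Ck_on (Suc 0) \<rho> V"
    using ld unfolding local_defining_function_def smooth_on_open_def by blast
  note fd = frechet_derivative_eq_grad[OF C, of x]
  have "frechet_derivative \<rho> (at x) \<noteq> (\<lambda>v. 0)"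
    using ld x by (auto simp: local_defining_function_def)
  then have n0: "n \<noteq> 0" using fd x by (auto simp: n_def)
  have nrm: "\<nu> x \<bullet> \<nu> x = 1" using nf x by (auto simp: unit_normal_field_def norm_eq_1)
  \<comment> \<open>The part of the normal orthogonal to the gradient. It is tangent, hence
    orthogonal to the normal as well, and so it vanishes.\<close>
  define X where "X = \<nu> x - ((\<nu> x \<bullet> n) / (n \<bullet> n)) *\<^sub>R n"
  have Xn: "X \<bullet> n = 0" using n0 by (simp add: X_def inner_diff_left)
  have "frechet_derivative \<rho> (at x) X = 0"
    using fd[of X] x Xn by (simp add: n_def inner_commute)
  then have "X \<in> tangent_space M x"
    using ld x unfolding tangent_space_def by blast
  then have X\<nu>: "X \<bullet> \<nu> x = 0" using nf x by (auto simp: unit_normal_field_def)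
  have "X \<bullet> X = X \<bullet> \<nu> x - ((\<nu> x \<bullet> n) / (n \<bullet> n)) * (X \<bullet> n)"
    by (subst (2) X_def) (simp add: inner_diff_right)
  then have "X = 0" using Xn X\<nu> by simp
  then have \<nu>: "\<nu> x = ((\<nu> x \<bullet> n) / (n \<bullet> n)) *\<^sub>R n" by (simp add: X_def)
  define c where "c = (\<nu> x \<bullet> n) / (n \<bullet> n)"
  have \<nu>c: "\<nu> x = c *\<^sub>R n" using \<nu> by (simp add: c_def)
  have c1: "c * c * (n \<bullet> n) = 1" using nrm by (simp add: \<nu>c)
  have c2: "\<nu> x \<bullet> n = c * (n \<bullet> n)" by (simp add: \<nu>c)
  have "(\<nu> x \<bullet> n) *\<^sub>R \<nu> x = (c * c * (n \<bullet> n)) *\<^sub>R n"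
    unfolding c2 by (simp add: \<nu>c mult_ac)
  then show "grad \<rho> x = (\<nu> x \<bullet> grad \<rho> x) *\<^sub>R \<nu> x" using c1 by (simp add: n_def)
  show "\<nu> x \<bullet> grad \<rho> x \<noteq> 0" using c1 c2 by (auto simp: n_def)
qed

lemma tangent_space_eq:
  assumes "smooth_hypersurface M" and nf: "unit_normal_field M \<nu>" and x: "x \<in> M"
  shows "tangent_space M x = {X. X \<bullet> \<nu> x = 0}"
proof -
  obtain V \<rho> where ld: "x \<in> V" "local_defining_function M V \<rho>"
    using assms unfolding smooth_hypersurface_def by blast
  have C: "Ck_on (Suc 0) \<rho> V"
    using ld(2) unfolding local_defining_function_def smooth_on_open_def by blast
  have "X \<in> tangent_space M x" if "X \<bullet> \<nu> x = 0" for X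
  proof -
    have "frechet_derivative \<rho> (at x) X = grad \<rho> x \<bullet> X"
      by (rule frechet_derivative_eq_grad[OF C ld(1)])
    also have "\<dots> = 0"
      using that x ld(1) by (subst unit_normal_parallel_grad(1)[OF nf ld(2)]) (auto simp: inner_commute)
    finally show ?thesis using ld unfolding tangent_space_def by blast
  qed
  then show ?thesis using nf x by (auto simp: unit_normal_field_def)
qed

text \<open>On \<open>M\<close> the gradient of \<open>\<rho>\<close> is \<open>u\<close> times the
  normal. Dividing \<open>\<rho>\<close> by \<open>u\<close> corrects this factor, since the
  derivative of \<open>1 / u\<close> enters multiplied by \<open>\<rho>\<close>, which is zero on
  \<open>M\<close>. The set \<open>V\<close> is shrunk so that \<open>u\<close> has no
  zeros.\<close>

lemma normal_potential:
  assumes hyp: "smooth_hypersurface M" and nf: "unit_normal_field M \<nu>" and p: "p \<in> M"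
  obtains V \<phi> where "open V" "p \<in> V" "\<And>k. Ck_on k \<phi> V" "M \<inter> V = {x \<in> V. \<phi> x = 0}"
    "\<And>x. x \<in> M \<inter> V \<Longrightarrow> grad \<phi> x = \<nu> x"
proof -
  obtain V1 \<rho> where V1: "p \<in> V1" and ld: "local_defining_function M V1 \<rho>"
    using hyp p unfolding smooth_hypersurface_def by blast
  obtain V2 F where V2: "p \<in> V2" and F: "smooth_on_open F V2" and F\<nu>: "\<forall>x\<in>M \<inter> V2. F x = \<nu> x"
    using nf p unfolding unit_normal_field_def smooth_along_def by blast
  define V0 where "V0 = V1 \<inter> V2"
  have o: "open V0" using ld F by (auto simp: V0_def local_defining_function_def smooth_on_open_def)
  have C\<rho>: "Ck_on k \<rho> V0" for k
    using ld by (auto simp: V0_def local_defining_function_def smooth_on_open_def intro: Ck_on_subset)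
  have CF: "Ck_on k F V0" for k
    using F by (auto simp: V0_def smooth_on_open_def intro: Ck_on_subset)
  define u where "u x = F x \<bullet> grad \<rho> x" for x
  have Cu: "Ck_on k u V0" for k
    unfolding u_def[abs_def] by (intro Ck_on_inner o CF Ck_on_grad C\<rho>)
  define V where "V = {x \<in> V0. u x \<noteq> 0}"
  have "continuous_on V0 u" using Cu[of 0] by simp
  then have oV: "open V"
    using continuous_open_preimage[OF _ o, of u "- {0}"] unfolding V_def
    by (simp add: vimage_def Int_def open_Compl)
  have sub: "V \<subseteq> V0" by (auto simp: V_def)
  have CV: "Ck_on k \<rho> V" "Ck_on k u V" for k using C\<rho> Cu Ck_on_subset[OF _ sub] by auto
  have u\<nu>: "grad \<rho> x = u x *\<^sub>R \<nu> x" "u x \<noteq> 0" if "x \<in> M" "x \<in> V0" for x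
    using unit_normal_parallel_grad[OF nf ld, of x] F\<nu> that by (auto simp: u_def V0_def)
  define \<phi> where "\<phi> x = \<rho> x * inverse (u x)" for x
  have zero: "M \<inter> V1 = {x \<in> V1. \<rho> x = 0}" using ld by (auto simp: local_defining_function_def)
  show thesis
  proof
    show "open V" by fact
    show "p \<in> V" using u\<nu>(2)[OF p] V1 V2 by (simp add: V_def V0_def)
    show C\<phi>: "Ck_on k \<phi> V" for k
      unfolding \<phi>_def[abs_def] by (intro Ck_on_mult oV CV Ck_on_inverse) (simp add: V_def)
    show "M \<inter> V = {x \<in> V. \<phi> x = 0}"
      using zero by (auto simp: \<phi>_def V_def V0_def)
    show "grad \<phi> x = \<nu> x" if "x \<in> M \<inter> V" for x
    proof -
      have x: "x \<in> M" "x \<in> V" "x \<in> V0" using that sub by auto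
      have r0: "\<rho> x = 0" using x zero by (auto simp: V0_def)
      note d\<rho> = has_derivative_grad[OF CV(1) x(2)]
        and di = Ck_on_SucD[OF Ck_on_inverse[OF oV CV(2)] x(2)]
      have "(\<phi> has_derivative (\<lambda>v. grad \<rho> x \<bullet> v * inverse (u x))) (at x)"
        unfolding \<phi>_def[abs_def]
        by (rule has_derivative_eq_rhs[OF has_derivative_mult[OF d\<rho> di]]) (auto simp: r0 V_def)
      moreover have "(\<phi> has_derivative (\<lambda>v. grad \<phi> x \<bullet> v)) (at x)"
        by (rule has_derivative_grad[OF C\<phi> x(2)])
      ultimately have "(\<lambda>v. grad \<rho> x \<bullet> v * inverse (u x)) = (\<lambda>v. grad \<phi> x \<bullet> v)"
        by (rule has_derivative_unique)
      then have "\<nu> x \<bullet> v = grad \<phi> x \<bullet> v" for v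
        using u\<nu>[OF x(1,3)] by (metis (no_types, lifting) inner_scaleR_left mult.commute mult.left_commute mult.right_neutral right_inverse)
      then show ?thesis by (metis vector_eq_rdot)
    qed
  qed
qed

text \<open>The map \<open>\<psi>\<close> replaces the coordinate along \<open>\<nu> p\<close> by
  \<open>\<phi>\<close>; its derivative at \<open>p\<close> is the identity because
  \<open>grad \<phi> p = \<nu> p\<close>. Its local inverse \<open>g\<close> carries the affine
  tangent hyperplane into \<open>M\<close>.\<close>

lemma hypersurface_chart:
  assumes hyp: "smooth_hypersurface M" and nf: "unit_normal_field M \<nu>" and p: "p \<in> M"
  obtains r g g' W where "r > 0" "g p = p" "\<And>X. g' p X = X"
    "\<And>y. y \<in> ball p r \<Longrightarrow> (g has_derivative g' y) (at y)"
    "\<And>y. y \<in> ball p r \<Longrightarrow> (y - p) \<bullet> \<nu> p = 0 \<Longrightarrow> g y \<in> M"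
    "open W" "p \<in> W" "\<And>x. x \<in> M \<inter> W \<Longrightarrow> \<exists>y\<in>ball p r. (y - p) \<bullet> \<nu> p = 0 \<and> g y = x"
proof -
  obtain V \<phi> where V: "open V" "p \<in> V" and C: "\<And>k. Ck_on k \<phi> V" and M: "M \<inter> V = {x \<in> V. \<phi> x = 0}"
    and gr: "\<And>x. x \<in> M \<inter> V \<Longrightarrow> grad \<phi> x = \<nu> x"
    by (fact normal_potential[OF assms])
  define N where "N = \<nu> p"
  have NN: "N \<bullet> N = 1" using nf p by (auto simp: N_def unit_normal_field_def norm_eq_1)
  define \<psi> where "\<psi> x = x + (\<phi> x - (x - p) \<bullet> N) *\<^sub>R N" for x
  define \<psi>' where "\<psi>' x = Blinfun (\<lambda>v. v + (grad \<phi> x \<bullet> v - v \<bullet> N) *\<^sub>R N)" for x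
  have app: "blinfun_apply (\<psi>' x) = (\<lambda>v. v + (grad \<phi> x \<bullet> v - v \<bullet> N) *\<^sub>R N)" for x
    unfolding \<psi>'_def by (intro bounded_linear_Blinfun_apply bounded_linear_intros)
  have app_p: "blinfun_apply (\<psi>' p) = (\<lambda>v. v)"
    using gr[of p] p V by (simp add: app N_def inner_commute)
  have \<psi>N: "(\<psi> x - p) \<bullet> N = \<phi> x" for x
    by (simp add: \<psi>_def inner_diff_left inner_add_left NN)
  have \<psi>M: "x \<in> M \<longleftrightarrow> (\<psi> x - p) \<bullet> N = 0" if "x \<in> V" for x
    using M that by (auto simp: \<psi>N)
  have dpsi: "(\<psi> has_derivative blinfun_apply (\<psi>' x)) (at x)" if "x \<in> V" for x
    unfolding app \<psi>_def[abs_def]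
    by (rule has_derivative_eq_rhs, (rule derivative_intros has_derivative_grad[OF C that])+) auto
  have cont: "continuous_on V \<psi>'"
  proof (rule continuous_on_blinfun_componentwise)
    fix i :: "complex ^ 'a"
    have "continuous_on V (grad \<phi>)" using Ck_on_grad[OF V(1) C, of 0] by simp
    then show "continuous_on V (\<lambda>x. blinfun_apply (\<psi>' x) i)"
      unfolding app by (intro continuous_intros)
  qed
  have inv: "id_blinfun o\<^sub>L \<psi>' p = id_blinfun"
    by (rule blinfun_eqI) (simp add: app_p)
  have "\<exists>U' V' g g'. open U' \<and> U' \<subseteq> V \<and> p \<in> U' \<and> open V' \<and> \<psi> p \<in> V' \<and> homeomorphism U' V' \<psi> g \<and>
      (\<forall>y\<in>V'. (g has_derivative g' y) (at y) \<and> g' y = inv (blinfun_apply (\<psi>' (g y))))"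
    by (rule inverse_function_theorem[OF V(1) _ cont V(2) inv], erule dpsi) blast
  then obtain U' V' g g' where U': "open U'" "U' \<subseteq> V" "p \<in> U'" and V': "open V'" "\<psi> p \<in> V'"
    and hom: "homeomorphism U' V' \<psi> g" and dg: "\<And>y. y \<in> V' \<Longrightarrow> (g has_derivative (g' y)) (at y)"
    and g': "\<And>y. y \<in> V' \<Longrightarrow> g' y = inv (blinfun_apply (\<psi>' (g y)))"
    by blast
  have \<psi>p: "\<psi> p = p" using p V M by (auto simp: \<psi>_def)
  have gp: "g p = p" using hom U' \<psi>p by (metis homeomorphism_apply1)
  obtain r where r: "r > 0" "ball p r \<subseteq> V'" using V' \<psi>p open_contains_ball by metis
  have gy: "g y \<in> U'" "\<psi> (g y) = y" if "y \<in> ball p r" for y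
    using that r hom by (auto simp: homeomorphism_def)
  show thesis
  proof
    show "r > 0" "g p = p" by fact+
    show "g' p X = X" for X
      using g'[of p] V' \<psi>p by (simp add: gp app_p inv_id[unfolded id_def])
    show "(g has_derivative g' y) (at y)" if "y \<in> ball p r" for y
      using that r dg by blast
    show "g y \<in> M" if "y \<in> ball p r" "(y - p) \<bullet> \<nu> p = 0" for y
      using gy[OF that(1)] \<psi>M U' that(2) by (auto simp: N_def)
    show "open (U' \<inter> \<psi> -` ball p r)"
      using hom U'(1) by (intro continuous_open_preimage) (auto simp: homeomorphism_def)
    show "p \<in> U' \<inter> \<psi> -` ball p r" using U' \<psi>p r by simp
    show "\<exists>y\<in>ball p r. (y - p) \<bullet> \<nu> p = 0 \<and> g y = x" if "x \<in> M \<inter> (U' \<inter> \<psi> -` ball p r)" for x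
      using that \<psi>M[of x] U' homeomorphism_apply1[OF hom, of x] by (intro bexI[of _ "\<psi> x"]) (auto simp: N_def)
  qed
qed

text \<open>The chart supplies a curve in \<open>M\<close> through \<open>x\<close> with velocity
  \<open>X\<close>, along which \<open>f\<close> is constant.\<close>

lemma tangent_derivative_zero:
  assumes hyp: "smooth_hypersurface M" and nf: "unit_normal_field M \<nu>"
    and V: "open V" and x: "x \<in> M \<inter> V"
    and f: "(f has_derivative D) (at x within M \<inter> V)" and c: "\<forall>y\<in>M \<inter> V. f y = c"
    and X: "X \<bullet> \<nu> x = 0"
  shows "D X = 0"
proof -
  have xM: "x \<in> M" using x by blast
  obtain r g g' W where r: "r > 0" and g: "g x = x" "\<And>X. g' x X = X"
    "\<And>y. y \<in> ball x r \<Longrightarrow> (g has_derivative g' y) (at y)"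
    "\<And>y. y \<in> ball x r \<Longrightarrow> (y - x) \<bullet> \<nu> x = 0 \<Longrightarrow> g y \<in> M"
    and "open W" "x \<in> W" "\<And>z. z \<in> M \<inter> W \<Longrightarrow> \<exists>y\<in>ball x r. (y - x) \<bullet> \<nu> x = 0 \<and> g y = z"
    by (fact hypersurface_chart[OF hyp nf xM])
  define \<gamma> where "\<gamma> s = g (x + s *\<^sub>R X)" for s :: real
  have dg: "(g has_derivative g' x) (at (x + 0 *\<^sub>R X))" using g(3)[of x] r by simp
  have d\<gamma>: "(\<gamma> has_derivative (\<lambda>s. s *\<^sub>R X)) (at 0)"
  proof -
    have "(\<gamma> has_derivative (\<lambda>s. g' x (s *\<^sub>R X))) (at 0)"
      unfolding \<gamma>_def
      by (rule has_derivative_compose[where f = "\<lambda>s. x + s *\<^sub>R X" and g = g, OF _ dg]) (auto intro!: derivative_eq_intros)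
    then show ?thesis by (simp add: g(2))
  qed
  have "isCont \<gamma> 0" using d\<gamma> has_derivative_continuous by blast
  then have "\<forall>\<^sub>F s in at 0. \<gamma> s \<in> V"
    unfolding isCont_def using topological_tendstoD[of \<gamma> "\<gamma> 0" "at 0" V] V x g(1) by (simp add: \<gamma>_def)
  moreover have "\<forall>\<^sub>F s in at (0::real). x + s *\<^sub>R X \<in> ball x r"
  proof -
    have "((\<lambda>s. x + s *\<^sub>R X) \<longlongrightarrow> x + 0 *\<^sub>R X) (at (0::real))" by (intro tendsto_intros)
    then show ?thesis using topological_tendstoD[of _ _ _ "ball x r"] r by fastforce
  qed
  ultimately have "\<forall>\<^sub>F s in at 0. \<gamma> s \<in> V \<and> x + s *\<^sub>R X \<in> ball x r"
    by (rule eventually_conj)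
  then obtain S where S: "open S" "0 \<in> S" "\<And>s. s \<in> S \<Longrightarrow> s \<noteq> 0 \<Longrightarrow> \<gamma> s \<in> V \<and> x + s *\<^sub>R X \<in> ball x r"
    unfolding eventually_at_topological by auto
  have \<gamma>0: "\<gamma> 0 = x" by (simp add: \<gamma>_def g(1))
  have MV: "\<gamma> s \<in> M \<inter> V" if "s \<in> S" for s
  proof (cases "s = 0")
    case False
    then show ?thesis using S(3)[OF that] g(4)[of "x + s *\<^sub>R X"] X by (auto simp: \<gamma>_def)
  qed (use \<gamma>0 x in simp)
  have "(f has_derivative D) (at (\<gamma> 0) within \<gamma> ` S)"
    using has_derivative_subset[OF f, of "\<gamma> ` S"] MV \<gamma>0 by auto
  then have "((\<lambda>s. f (\<gamma> s)) has_derivative (\<lambda>s. D (s *\<^sub>R X))) (at 0 within S)"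
    using has_derivative_in_compose[of \<gamma> _ 0 S f D] d\<gamma> has_derivative_at_withinI by blast
  then have "((\<lambda>s. f (\<gamma> s)) has_derivative (\<lambda>s. D (s *\<^sub>R X))) (at 0)"
    using S(1,2) at_within_open by metis
  then have "((\<lambda>s. c) has_derivative (\<lambda>s. D (s *\<^sub>R X))) (at 0)"
    by (rule has_derivative_transform_within_open[OF _ S(1,2)]) (use MV c in auto)
  then have "(\<lambda>s. D (s *\<^sub>R X)) = (\<lambda>s. 0)"
    using has_derivative_const has_derivative_unique by blast
  then show ?thesis by (metis scaleR_one)
qed

lemma curve_tangent:
  assumes hyp: "smooth_hypersurface M" and nf: "unit_normal_field M \<nu>"
    and S: "open S" "s \<in> S" and \<gamma>: "\<And>s. s \<in> S \<Longrightarrow> \<gamma> s \<in> M"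
    and d: "(\<gamma> has_derivative (\<lambda>h. h *\<^sub>R X)) (at (s::real))"
  shows "X \<bullet> \<nu> (\<gamma> s) = 0"
proof -
  obtain V \<phi> where V: "open V" "\<gamma> s \<in> V" and C: "\<And>k. Ck_on k \<phi> V" and M: "M \<inter> V = {x \<in> V. \<phi> x = 0}"
    and gr: "\<And>x. x \<in> M \<inter> V \<Longrightarrow> grad \<phi> x = \<nu> x"
    by (fact normal_potential[OF hyp nf \<gamma>[OF S(2)]])
  have "isCont \<gamma> s" using d has_derivative_continuous by blast
  then have "\<forall>\<^sub>F u in at s. \<gamma> u \<in> V \<and> u \<in> S"
    unfolding isCont_def using topological_tendstoD V S
    by (intro eventually_conj) (auto intro: eventually_at_in_open')
  then obtain S' where S': "open S'" "s \<in> S'" "\<And>u. u \<in> S' \<Longrightarrow> u \<noteq> s \<Longrightarrow> \<gamma> u \<in> V \<and> u \<in> S"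
    unfolding eventually_at_topological by auto
  have z: "\<phi> (\<gamma> u) = 0" if "u \<in> S'" for u
    using S'(3)[OF that] \<gamma> M V S(2) by (cases "u = s") auto
  have "((\<lambda>u. \<phi> (\<gamma> u)) has_derivative (\<lambda>h. grad \<phi> (\<gamma> s) \<bullet> (h *\<^sub>R X))) (at s)"
    by (rule has_derivative_compose[OF d has_derivative_grad[OF C V(2)]])
  then have "((\<lambda>u. 0) has_derivative (\<lambda>h. grad \<phi> (\<gamma> s) \<bullet> (h *\<^sub>R X))) (at s)"
    by (rule has_derivative_transform_within_open[OF _ S'(1,2)]) (use z in auto)
  then have "(\<lambda>h. grad \<phi> (\<gamma> s) \<bullet> (h *\<^sub>R X)) = (\<lambda>h. 0)"
    using has_derivative_const has_derivative_unique by blast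
  then have "grad \<phi> (\<gamma> s) \<bullet> X = 0" by (metis scaleR_one)
  then show ?thesis using gr[of "\<gamma> s"] \<gamma>[OF S(2)] V(2) by (simp add: inner_commute)
qed

text \<open>Nearby points are joined to \<open>p\<close> by the chart images of segments in the
  tangent hyperplane, and connectedness globalises the local constancy.\<close>

lemma constant_on_hypersurface:
  fixes f :: "complex ^ 'k \<Rightarrow> 'b::real_normed_vector"
  assumes hyp: "smooth_hypersurface M" and nf: "unit_normal_field M \<nu>" and "connected M"
    and f: "\<And>x. x \<in> M \<Longrightarrow> \<exists>D. (f has_derivative D) (at x within M) \<and> (\<forall>X. X \<bullet> \<nu> x = 0 \<longrightarrow> D X = 0)"
  shows "f constant_on M"
proof (rule locally_constant_imp_constant[OF \<open>connected M\<close>])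
  fix p assume p: "p \<in> M"
  obtain r g g' W where r: "r > 0" and g: "g p = p" and "\<And>X. g' p X = X"
    and g': "\<And>y. y \<in> ball p r \<Longrightarrow> (g has_derivative g' y) (at y)"
    and gM: "\<And>y. y \<in> ball p r \<Longrightarrow> (y - p) \<bullet> \<nu> p = 0 \<Longrightarrow> g y \<in> M"
    and W: "open W" "p \<in> W" "\<And>x. x \<in> M \<inter> W \<Longrightarrow> \<exists>y\<in>ball p r. (y - p) \<bullet> \<nu> p = 0 \<and> g y = x"
    by (fact hypersurface_chart[OF hyp nf p])
  have "f x = f p" if x: "x \<in> M \<inter> W" for x
  proof -
    obtain y where y: "y \<in> ball p r" "(y - p) \<bullet> \<nu> p = 0" "g y = x" using W(3)[OF x] by blast
    define l where "l s = p + s *\<^sub>R (y - p)" for s :: real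
    \<comment> \<open>A whole preimage instead of the unit interval: \<open>curve_tangent\<close>
      wants an open parameter set, the vanishing derivative argument a convex one.\<close>
    define S where "S = l -` ball p r"
    define \<gamma> where "\<gamma> s = g (l s)" for s
    have dl: "(l has_derivative (\<lambda>h. h *\<^sub>R (y - p))) (at s)" for s
      unfolding l_def by (auto intro!: derivative_eq_intros)
    have "continuous_on UNIV l" unfolding l_def by (intro continuous_intros)
    then have oS: "open S" unfolding S_def using open_vimage[of "ball p r" l] by simp
    have S_eq: "S = {s. \<bar>s\<bar> * norm (y - p) < r}"
      by (auto simp: S_def l_def dist_norm)
    have cS: "convex S"
      unfolding S_def
    proof (rule convexI)
      fix a b u v :: real assume *: "a \<in> l -` ball p r" "b \<in> l -` ball p r" "0 \<le> u" "0 \<le> v" "u + v = 1"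
      have "l (u *\<^sub>R a + v *\<^sub>R b) = u *\<^sub>R l a + v *\<^sub>R l b"
        unfolding l_def using *(5) by (simp add: algebra_simps flip: scaleR_add_left)
      then show "u *\<^sub>R a + v *\<^sub>R b \<in> l -` ball p r"
        using convexD[OF convex_ball, of "l a" p r "l b" u v] * by simp
    qed
    have \<gamma>M: "\<gamma> s \<in> M" if "s \<in> S" for s
      unfolding \<gamma>_def using that y(2) by (intro gM) (auto simp: S_def l_def)
    have d\<gamma>: "(\<gamma> has_derivative (\<lambda>h. h *\<^sub>R g' (l s) (y - p))) (at s)" if "s \<in> S" for s
    proof -
      have dg: "(g has_derivative g' (l s)) (at (l s))" using that g' by (simp add: S_def)
      have "(\<gamma> has_derivative (\<lambda>h. g' (l s) (h *\<^sub>R (y - p)))) (at s)"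
        unfolding \<gamma>_def by (rule has_derivative_compose[OF dl dg])
      then show ?thesis by (simp add: linear_cmul[OF has_derivative_linear[OF dg]])
    qed
    have "((\<lambda>s. f (\<gamma> s)) has_derivative (\<lambda>h. 0)) (at s within S)" if s: "s \<in> S" for s
    proof -
      obtain D where D: "(f has_derivative D) (at (\<gamma> s) within M)" "\<forall>X. X \<bullet> \<nu> (\<gamma> s) = 0 \<longrightarrow> D X = 0"
        using f \<gamma>M[OF s] by blast
      have "D (g' (l s) (y - p)) = 0"
        using D(2) curve_tangent[OF hyp nf oS s \<gamma>M d\<gamma>[OF s]] by blast
      then have z: "D (h *\<^sub>R g' (l s) (y - p)) = 0" for h
        by (simp add: linear_cmul[OF has_derivative_linear[OF D(1)]])
      have "(f has_derivative D) (at (\<gamma> s) within \<gamma> ` S)"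
        using D(1) by (rule has_derivative_subset) (use \<gamma>M in auto)
      from has_derivative_in_compose[OF has_derivative_at_withinI[OF d\<gamma>[OF s]] this]
      show ?thesis by (simp add: z)
    qed
    moreover have "0 \<in> S" "1 \<in> S" using y(1) r by (auto simp: S_def l_def)
    ultimately have "f (\<gamma> 1) = f (\<gamma> 0)"
      using has_derivative_zero_unique[OF cS, of "\<lambda>s. f (\<gamma> s)"] by blast
    then show ?thesis by (simp add: \<gamma>_def l_def y(3) g)
  qed
  note const = this
  show "\<exists>T. openin (top_of_set M) T \<and> p \<in> T \<and> (\<forall>x\<in>T. f x = f p)"
  proof (intro exI conjI ballI)
    show "openin (top_of_set M) (M \<inter> W)" using W(1) by (rule openin_open_Int)
    show "p \<in> M \<inter> W" using W(2) p by blast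
  qed (rule const)
qed

section \<open>Unitary coordinates adapted to a projection\<close>

context complex_structure
begin

text \<open>Hermitian orthonormality in real terms: \<open>b' \<in> hor b\<close> kills both the
  real and the imaginary part of the hermitian product.\<close>

definition unitary_set :: "'a set \<Rightarrow> bool" where
  "unitary_set B \<longleftrightarrow> (\<forall>b\<in>B. norm b = 1 \<and> (\<forall>b'\<in>B. b' \<noteq> b \<longrightarrow> b' \<in> hor b))"

lemma unitary_set_inner:
  assumes "unitary_set B" "b \<in> B" "b' \<in> B"
  shows "b \<bullet> b' = (if b = b' then 1 else 0)" "J b \<bullet> b' = 0" "b \<bullet> J b' = 0"
    "J b \<bullet> J b' = (if b = b' then 1 else 0)"
proof -
  have *: "b \<bullet> b' = (if b = b' then 1 else 0) \<and> b \<bullet> J b' = 0"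
    using assms by (auto simp: unitary_set_def hor_def norm_eq_1)
  then show "b \<bullet> b' = (if b = b' then 1 else 0)" "b \<bullet> J b' = 0" "J b \<bullet> J b' = (if b = b' then 1 else 0)"
    by (auto simp: J_isometry)
  show "J b \<bullet> b' = 0" using * by (simp add: J_skew)
qed

lemma unitary_set_independent:
  assumes "unitary_set B"
  shows "independent (B \<union> J ` B)" "finite B" "card (B \<union> J ` B) = 2 * card B" "2 * card B \<le> DIM('a)"
proof -
  note u = unitary_set_inner[OF assms]
  have "pairwise orthogonal (B \<union> J ` B)"
    unfolding pairwise_def orthogonal_def using u by auto
  moreover have "0 \<notin> B \<union> J ` B"
  proof
    assume "0 \<in> B \<union> J ` B"
    then obtain b where b: "b \<in> B" "b = 0 \<or> J b = 0" by auto
    then show False using u(1)[OF b(1) b(1)] u(4)[OF b(1) b(1)] by auto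
  qed
  ultimately show ind: "independent (B \<union> J ` B)" by (rule pairwise_orthogonal_independent)
  then have fin: "finite (B \<union> J ` B)" "card (B \<union> J ` B) \<le> DIM('a)"
    using independent_bound by auto
  then show f: "finite B" by simp
  have inj: "inj_on J B" by (rule inj_on_inverseI[where g = "\<lambda>v. - J v"]) (simp add: J_linear_simps)
  have "B \<inter> J ` B = {}"
  proof (rule ccontr)
    assume "B \<inter> J ` B \<noteq> {}"
    then obtain b where b: "b \<in> B" "J b \<in> B" by blast
    then show False using u(2)[OF b] u(4)[OF b(1) b(1)] by simp
  qed
  then show c: "card (B \<union> J ` B) = 2 * card B"
    using f inj by (simp add: card_Un_disjoint card_image)
  then show "2 * card B \<le> DIM('a)" using fin by simp
qed

text \<open>A set of maximal cardinality is complete: a non-zero vector of \<open>W\<close>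
  hermitian-orthogonal to it could be normalised and added. The bound on cardinalities is
  \<open>unitary_set_independent(4)\<close>.\<close>

lemma unitary_set_extend:
  assumes W: "subspace W" and B0: "B0 \<subseteq> W" "unitary_set B0"
  obtains B where "B0 \<subseteq> B" "B \<subseteq> W" "unitary_set B" "\<And>w. w \<in> W \<Longrightarrow> (\<forall>b\<in>B. w \<in> hor b) \<Longrightarrow> w = 0"
proof -
  define Q where "Q B \<longleftrightarrow> B0 \<subseteq> B \<and> B \<subseteq> W \<and> unitary_set B" for B
  have "Q B0" using B0 by (simp add: Q_def)
  moreover have "\<forall>B. Q B \<longrightarrow> card B < Suc (DIM('a))"
    using unitary_set_independent(4) by (fastforce simp: Q_def)
  ultimately obtain B where B: "Q B" "\<And>B'. Q B' \<Longrightarrow> card B' \<le> card B"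
    using ex_has_greatest_nat[of Q B0 card "Suc (DIM('a))"] by blast
  have fin: "finite B" using B(1) unitary_set_independent(2) by (auto simp: Q_def)
  show thesis
  proof (rule that)
    show "B0 \<subseteq> B" "B \<subseteq> W" "unitary_set B" using B(1) by (auto simp: Q_def)
    fix w assume w: "w \<in> W" "\<forall>b\<in>B. w \<in> hor b"
    show "w = 0"
    proof (rule ccontr)
      assume w0: "w \<noteq> 0"
      define v where "v = (1 / norm w) *\<^sub>R w"
      have v: "norm v = 1" "v \<in> W" using w0 w(1) W by (auto simp: v_def subspace_scale)
      have vh: "v \<in> hor b" "b \<in> hor v" if "b \<in> B" for b
        using w(2) that J_skew[of b w] J_skew[of w b] by (auto simp: v_def hor_def J_linear_simps inner_commute)
      have vB: "v \<notin> B"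
      proof
        assume "v \<in> B"
        then have "v \<bullet> v = 0" using vh by (auto simp: hor_def)
        then show False using v(1) by simp
      qed
      have "unitary_set (insert v B)"
        using B(1) v(1) vh by (auto simp: Q_def unitary_set_def)
      then have "Q (insert v B)" using B(1) v(2) by (auto simp: Q_def)
      from B(2)[OF this] show False using vB fin by simp
    qed
  qed
qed

lemma unitary_set_expand:
  assumes W: "subspace W" "\<And>w. w \<in> W \<Longrightarrow> J w \<in> W" and B: "B \<subseteq> W" "unitary_set B"
    and complete: "\<And>w. w \<in> W \<Longrightarrow> (\<forall>b\<in>B. w \<in> hor b) \<Longrightarrow> w = 0" and v: "v \<in> W"
  shows "v = (\<Sum>b\<in>B. (v \<bullet> b) *\<^sub>R b + (v \<bullet> J b) *\<^sub>R J b)"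
    and "(norm v)\<^sup>2 = (\<Sum>b\<in>B. (v \<bullet> b)\<^sup>2 + (v \<bullet> J b)\<^sup>2)"
proof -
  define v' where "v' = (\<Sum>b\<in>B. (v \<bullet> b) *\<^sub>R b + (v \<bullet> J b) *\<^sub>R J b)"
  note u = unitary_set_inner[OF B(2)] and fin = unitary_set_independent(2)[OF B(2)]
  have "v' \<in> W"
    unfolding v'_def using W B(1) by (intro subspace_sum subspace_add subspace_scale) auto
  then have "v - v' \<in> W" using W(1) v by (simp add: subspace_diff)
  moreover have "v - v' \<in> hor c" if c: "c \<in> B" for c
  proof -
    have "v' \<bullet> c = (\<Sum>b\<in>B. if b = c then v \<bullet> b else 0)"
      unfolding v'_def inner_sum_left using c by (intro sum.cong refl) (simp add: inner_add_left u)
    moreover have "v' \<bullet> J c = (\<Sum>b\<in>B. if b = c then v \<bullet> J b else 0)"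
      unfolding v'_def inner_sum_left using c by (intro sum.cong refl) (simp add: inner_add_left u)
    ultimately show ?thesis using c fin by (simp add: hor_def inner_diff_left)
  qed
  ultimately have "v - v' = 0" by (intro complete) auto
  then show 1: "v = (\<Sum>b\<in>B. (v \<bullet> b) *\<^sub>R b + (v \<bullet> J b) *\<^sub>R J b)" by (simp add: v'_def)
  have "(norm v)\<^sup>2 = v \<bullet> v" by (rule power2_norm_eq_inner)
  also have "\<dots> = v \<bullet> (\<Sum>b\<in>B. (v \<bullet> b) *\<^sub>R b + (v \<bullet> J b) *\<^sub>R J b)" using 1 by metis
  also have "\<dots> = (\<Sum>b\<in>B. (v \<bullet> b)\<^sup>2 + (v \<bullet> J b)\<^sup>2)"
    by (simp add: inner_sum_right inner_add_right power2_eq_square)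
  finally show "(norm v)\<^sup>2 = (\<Sum>b\<in>B. (v \<bullet> b)\<^sup>2 + (v \<bullet> J b)\<^sup>2)" .
qed

lemma projection_unitary_sets:
  assumes R: "linear R" "\<And>v. R (R v) = R v" "\<And>v w. R v \<bullet> w = v \<bullet> R w" "\<And>v. R (J v) = J (R v)"
    and u: "norm u = 1" "R u = u" and w: "w \<in> hor u" "w \<noteq> 0" "R w = w"
  obtains B1 B2 where "unitary_set (B1 \<union> B2)" "finite B1" "finite B2" "B1 \<inter> B2 = {}" "2 \<le> card B1"
    "2 * card (B1 \<union> B2) = DIM('a)" "\<And>v. (norm (R v))\<^sup>2 = (\<Sum>b\<in>B1. (v \<bullet> b)\<^sup>2 + (v \<bullet> J b)\<^sup>2)"
proof -
  define W1 where "W1 = {v. R v = v}"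
  define W2 where "W2 = {v. R v = 0}"
  have W1: "subspace W1" and W2: "subspace W2"
    unfolding W1_def W2_def subspace_def using R(1) by (auto simp: linear_add linear_cmul linear_0)
  define w' where "w' = (1 / norm w) *\<^sub>R w"
  have w': "norm w' = 1" "w' \<in> hor u" "R w' = w'"
    using w R(1) by (auto simp: w'_def hor_def linear_cmul)
  have u_hor: "u \<in> hor w'" using w'(2) J_skew[of u w'] by (auto simp: hor_def inner_commute)
  have ne: "u \<noteq> w'" using w'(2) u(1) by (auto simp: hor_def)
  \<comment> \<open>Starting the basis of the range from these two vectors yields
    \<open>2 \<le> card B1\<close>.\<close>
  have B0: "{u, w'} \<subseteq> W1" "unitary_set {u, w'}"
    using u w' u_hor by (auto simp: W1_def unitary_set_def)
  obtain B1 where B1: "{u, w'} \<subseteq> B1" "B1 \<subseteq> W1" "unitary_set B1"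
    and c1: "\<And>w. w \<in> W1 \<Longrightarrow> (\<forall>b\<in>B1. w \<in> hor b) \<Longrightarrow> w = 0"
    by (fact unitary_set_extend[OF W1 B0])
  have e: "{} \<subseteq> W2" "unitary_set {}" by (auto simp: unitary_set_def)
  obtain B2 where "{} \<subseteq> B2" and B2: "B2 \<subseteq> W2" "unitary_set B2"
    and c2: "\<And>w. w \<in> W2 \<Longrightarrow> (\<forall>b\<in>B2. w \<in> hor b) \<Longrightarrow> w = 0"
    by (fact unitary_set_extend[OF W2 e])
  have R1: "R b = b" if "b \<in> B1" for b using that B1 by (auto simp: W1_def)
  have R2: "R b = 0" if "b \<in> B2" for b using that B2 by (auto simp: W2_def)
  have perp: "b \<bullet> b' = 0" "b \<bullet> J b' = 0" if "b \<in> B1" "b' \<in> B2" for b b'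
    using R(3)[of b b'] R(3)[of b "J b'"] R1[OF that(1)] R2[OF that(2)] by (simp_all add: R(4) J_linear_simps)
  have "b \<in> hor b'" "b' \<in> hor b" if b: "b \<in> B1" "b' \<in> B2" for b b'
  proof -
    have "b' \<bullet> J b = - (b \<bullet> J b')" using J_skew[of b' b] by (simp add: inner_commute)
    then show "b \<in> hor b'" "b' \<in> hor b" using perp[OF b] by (auto simp: hor_def inner_commute)
  qed
  then have uB: "unitary_set (B1 \<union> B2)"
    using B1(3) B2(2) by (auto simp: unitary_set_def)
  \<comment> \<open>Self-adjointness and commutation with \<open>J\<close> make \<open>R v\<close>
    orthogonal to \<open>B1\<close> too, so \<open>R v = 0\<close>; then \<open>v\<close> lies in
    the kernel, where \<open>B2\<close> is complete.\<close>
  have complete: "v = 0" if h: "\<forall>b\<in>B1 \<union> B2. v \<in> hor b" for v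
  proof -
    have "R v \<in> hor b" if "b \<in> B1" for b
      using h that by (simp add: hor_def R(3) R(4) R1)
    then have "R v = 0" by (intro c1) (auto simp: W1_def R(2))
    then show ?thesis by (intro c2) (use h in \<open>auto simp: W2_def\<close>)
  qed
  note fin = unitary_set_independent(2)[OF B1(3)] unitary_set_independent(2)[OF B2(2)]
  have disj: "B1 \<inter> B2 = {}"
  proof (rule ccontr)
    assume "B1 \<inter> B2 \<noteq> {}"
    then obtain b where b: "b \<in> B1" "b \<in> B2" by blast
    then have "b = 0" using R1 R2 by metis
    then show False using unitary_set_inner(1)[OF B1(3) b(1) b(1)] by simp
  qed
  have "v \<in> span (B1 \<union> B2 \<union> J ` (B1 \<union> B2))" for v
  proof -
    have "v = (\<Sum>b\<in>B1 \<union> B2. (v \<bullet> b) *\<^sub>R b + (v \<bullet> J b) *\<^sub>R J b)"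
      by (rule unitary_set_expand(1)[OF subspace_UNIV]) (use uB complete in auto)
    also have "\<dots> \<in> span (B1 \<union> B2 \<union> J ` (B1 \<union> B2))"
      by (intro span_sum span_add span_scale span_base) auto
    finally show ?thesis .
  qed
  then have "span (B1 \<union> B2 \<union> J ` (B1 \<union> B2)) = UNIV" by blast
  then have dim: "2 * card (B1 \<union> B2) = DIM('a)"
    using dim_eq_card[of "B1 \<union> B2 \<union> J ` (B1 \<union> B2)" UNIV] unitary_set_independent(1,3)[OF uB]
    by (simp add: dim_UNIV)
  have "card {u, w'} \<le> card B1" using B1(1) fin(1) by (rule card_mono[rotated])
  then have c2: "2 \<le> card B1" using ne by simp
  have norm_eq: "(norm (R v))\<^sup>2 = (\<Sum>b\<in>B1. (v \<bullet> b)\<^sup>2 + (v \<bullet> J b)\<^sup>2)" for v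
  proof -
    have "(norm (R v))\<^sup>2 = (\<Sum>b\<in>B1. (R v \<bullet> b)\<^sup>2 + (R v \<bullet> J b)\<^sup>2)"
      by (rule unitary_set_expand(2)[OF W1 _ B1(2,3) c1]) (auto simp: W1_def R(2,4))
    also have "\<dots> = (\<Sum>b\<in>B1. (v \<bullet> b)\<^sup>2 + (v \<bullet> J b)\<^sup>2)"
      by (intro sum.cong refl) (simp add: R(3) R(4) R1)
    finally show ?thesis .
  qed
  show thesis by (rule that[OF uB fin disj c2 dim norm_eq])
qed

end

lemma complex_structure_vec: "complex_structure (\<lambda>v :: complex ^ 'k::finite. \<i> *s v)"
proof (rule complex_structure.intro)
  show "linear (\<lambda>v :: complex ^ 'k. \<i> *s v)"
    by (rule linearI) (auto simp: vec_eq_iff algebra_simps)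
  show "\<i> *s (\<i> *s v) = - v" for v :: "complex ^ 'k"
    by (simp add: vec_eq_iff)
  show "(\<i> *s v) \<bullet> (\<i> *s w) = v \<bullet> w" for v w :: "complex ^ 'k"
    by (simp add: inner_vec_def inner_complex_def algebra_simps)
qed

interpretation cvec: complex_structure "\<lambda>v :: complex ^ 'k::finite. \<i> *s v"
  by (rule complex_structure_vec)

lemma hermitian_product_vec:
  fixes b z :: "complex ^ 'k"
  shows "(\<Sum>j\<in>UNIV. cnj (b $ j) * z $ j) = Complex (z \<bullet> b) (z \<bullet> (\<i> *s b))"
  by (auto simp: complex_eq_iff inner_vec_def inner_complex_def algebra_simps intro!: sum.cong)

text \<open>The unitary matrix has the rows \<open>b\<^sup>*\<close>, those for \<open>b \<in> B1\<close> in the last positions.\<close>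

lemma projection_norm_isometry:
  fixes R :: "complex ^ 'k \<Rightarrow> complex ^ 'k" and e :: "nat \<Rightarrow> 'k::finite"
  assumes card: "CARD('k) = n + 1" and e: "bij_betw e {1..n+1} (UNIV :: 'k set)"
    and R: "linear R" "\<And>v. R (R v) = R v" "\<And>v w. R v \<bullet> w = v \<bullet> R w" "\<And>v. R (\<i> *s v) = \<i> *s R v"
    and u: "norm u = 1" "R u = u" and w: "w \<in> cvec.hor u" "w \<noteq> 0" "R w = w"
  obtains U m where "unitary_matrix U" "1 \<le> m" "m \<le> n"
    "\<And>z. (\<Sum>i=m..n+1. (cmod ((U *v z) $ e i))\<^sup>2) = (norm (R z))\<^sup>2"
proof -
  obtain B1 B2 where B: "cvec.unitary_set (B1 \<union> B2)" and fin: "finite B1" "finite B2" and disj: "B1 \<inter> B2 = {}"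
    and c2: "2 \<le> card B1" and dim: "2 * card (B1 \<union> B2) = DIM(complex ^ 'k)"
    and nrm: "\<And>v. (norm (R v))\<^sup>2 = (\<Sum>b\<in>B1. (v \<bullet> b)\<^sup>2 + (v \<bullet> (\<i> *s b))\<^sup>2)"
    by (fact cvec.projection_unitary_sets[OF R u w])
  have cards: "card B1 + card B2 = n + 1"
    using dim card disj fin by (simp add: card_Un_disjoint)
  \<comment> \<open>Chosen so that \<open>{m..n+1}\<close> has \<open>card B1\<close> elements.
    \<open>m = 1\<close> means that \<open>R\<close> is the identity, and \<open>m \<le> n\<close>
    is \<open>2 \<le> card B1\<close>.\<close>
  define m where "m = n + 2 - card B1"
  have m: "1 \<le> m" "m \<le> n" using cards c2 by (auto simp: m_def)
  have cm: "card {m..n+1} = card B1" "card {1..<m} = card B2" using cards by (auto simp: m_def)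
  obtain f1 where f1: "bij_betw f1 {m..n+1} B1"
    using finite_same_card_bij[OF _ fin(1) cm(1)] by auto
  obtain f2 where f2: "bij_betw f2 {1..<m} B2"
    using finite_same_card_bij[OF _ fin(2) cm(2)] by auto
  define f where "f i = (if i < m then f2 i else f1 i)" for i
  have "bij_betw f {1..<m} B2" using f2 by (subst bij_betw_cong[of _ f f2]) (auto simp: f_def)
  moreover have ff1: "bij_betw f {m..n+1} B1" using f1 by (subst bij_betw_cong[of _ f f1]) (auto simp: f_def)
  ultimately have "bij_betw f ({1..<m} \<union> {m..n+1}) (B2 \<union> B1)"
    using disj by (intro bij_betw_combine) auto
  moreover have "{1..<m} \<union> {m..n+1} = {1..n+1}" using m by auto
  ultimately have f: "bij_betw f {1..n+1} (B1 \<union> B2)" by (simp add: Un_commute)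
  define g where "g = f \<circ> inv_into {1..n+1} e"
  have g: "bij_betw g UNIV (B1 \<union> B2)"
    unfolding g_def by (rule bij_betw_trans[OF bij_betw_inv_into[OF e] f])
  have ge: "g (e i) = f i" if "i \<in> {1..n+1}" for i
    using e that by (simp add: g_def bij_betw_def inv_into_f_f)
  define U :: "complex ^ 'k ^ 'k" where "U = (\<chi> i j. cnj (g i $ j))"
  have Uz: "(U *v z) $ i = Complex (z \<bullet> g i) (z \<bullet> (\<i> *s g i))" for z i
    by (simp add: U_def matrix_vector_mult_def hermitian_product_vec)
  have "U ** map_matrix cnj (transpose U) = mat 1"
  proof -
    have "(\<Sum>k\<in>UNIV. cnj (g i $ k) * g j $ k) = (if i = j then 1 else 0)" for i j
    proof -
      have ij: "g i \<in> B1 \<union> B2" "g j \<in> B1 \<union> B2" using bij_betwE[OF g] by auto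
      have "g i = g j \<longleftrightarrow> i = j" using g by (auto simp: bij_betw_def inj_on_def)
      then show ?thesis
        unfolding hermitian_product_vec using cvec.unitary_set_inner[OF B ij(2,1)] by (auto simp: complex_eq_iff)
    qed
    then show ?thesis
      by (simp add: vec_eq_iff matrix_matrix_mult_def mat_def transpose_def U_def map_matrix_def)
  qed
  then have U: "unitary_matrix U"
    unfolding unitary_matrix_def using matrix_left_right_inverse by blast
  have norm_eq: "(\<Sum>i=m..n+1. (cmod ((U *v z) $ e i))\<^sup>2) = (norm (R z))\<^sup>2" for z
  proof -
    have "(\<Sum>i=m..n+1. (cmod ((U *v z) $ e i))\<^sup>2) = (\<Sum>i=m..n+1. (z \<bullet> f i)\<^sup>2 + (z \<bullet> (\<i> *s f i))\<^sup>2)"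
      using m(1) by (intro sum.cong refl) (auto simp: Uz ge cmod_def)
    also have "\<dots> = (\<Sum>b\<in>B1. (z \<bullet> b)\<^sup>2 + (z \<bullet> (\<i> *s b))\<^sup>2)"
      by (rule sum.reindex_bij_betw[OF ff1])
    finally show ?thesis by (simp add: nrm)
  qed
  show thesis by (rule that[OF U m norm_eq])
qed

section \<open>The Levi form\<close>

text \<open>Within \<open>M\<close> derivatives are not unique, and
  \<open>frechet_derivative\<close> picks one of them. Two choices differ by a derivative of the
  zero function, which vanishes on tangent vectors.\<close>

lemma frechet_derivative_tangent:
  assumes "smooth_hypersurface M" "unit_normal_field M \<nu>" and x: "x \<in> M"
    and f: "(f has_derivative D) (at x within M)" and X: "X \<bullet> \<nu> x = 0"
  shows "frechet_derivative f (at x within M) X = D X"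
proof -
  have "(f has_derivative frechet_derivative f (at x within M)) (at x within M)"
    using differentiableI[OF f] frechet_derivative_works by blast
  from has_derivative_diff[OF this f]
  have "((\<lambda>y. f y - f y) has_derivative (\<lambda>X. frechet_derivative f (at x within M) X - D X)) (at x within M \<inter> UNIV)"
    by simp
  from tangent_derivative_zero[OF assms(1,2) open_UNIV _ this _ X, of 0] x show ?thesis by simp
qed

text \<open>Type (1,0) means Z = v - iJv. Both parts are tangent exactly when \<open>v\<close> is
  orthogonal to \<open>\<nu>\<close> and \<open>J \<nu>\<close>.\<close>

lemma hol_tangent_space_iff:
  assumes "smooth_hypersurface M" "unit_normal_field M \<nu>" "x \<in> M"
  shows "Z \<in> hol_tangent_space M x \<longleftrightarrow> (\<exists>v\<in>cvec.hor (\<nu> x). Z = (v, - (\<i> *s v)))"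
proof -
  have T: "(v, w) \<in> T10 \<longleftrightarrow> w = - (\<i> *s v)" for v w :: "complex ^ 'a"
  proof
    assume "(v, w) \<in> T10"
    then have "\<i> *s v = - w" by (simp add: T10_def JC_def complexify_def cscale_def)
    then show "w = - (\<i> *s v)" by simp
  next
    assume "w = - (\<i> *s v)"
    then show "(v, w) \<in> T10"
      by (simp add: T10_def JC_def complexify_def cscale_def cvec.J_linear_simps del: vector_smult_assoc)
  qed
  have "- (\<i> *s v) \<bullet> \<nu> x = v \<bullet> (\<i> *s \<nu> x)" for v by (simp add: cvec.J_skew)
  then show ?thesis
    unfolding hol_tangent_space_def complex_tangent_space_def tangent_space_eq[OF assms]
    by (cases Z) (auto simp: T cvec.hor_def)
qed

lemma gC_cscale: "gC (cscale c Z) W = c * gC Z W"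
  by (auto simp: gC_def cscale_def complex_eq_iff algebra_simps)

lemma gC_sum: "gC (\<Sum>i\<in>I. Z i) W = (\<Sum>i\<in>I. gC (Z i) W)"
  by (auto simp: gC_def complex_eq_iff fst_sum snd_sum inner_sum_left sum.distrib sum_subtractf)

text \<open>Up to a constant factor, the contraction with the inverse metric is the sum over the horizontal
  projections of any real orthonormal basis.\<close>

lemma levi_trace_frame:
  fixes A :: "complex ^ 'k::finite \<Rightarrow> complex ^ 'k" and Z :: "nat \<Rightarrow> 'k cvec"
  assumes A: "linear A" "\<And>v w. A v \<bullet> w = v \<bullet> A w" and u: "norm u = 1"
    and Z: "\<And>\<alpha>. \<alpha> \<in> {1..n} \<Longrightarrow> X \<alpha> \<in> cvec.hor u" "\<And>\<alpha>. \<alpha> \<in> {1..n} \<Longrightarrow> Z \<alpha> = (X \<alpha>, - (\<i> *s X \<alpha>))"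
    and span: "\<And>v. v \<in> cvec.hor u \<Longrightarrow> \<exists>c. (v, - (\<i> *s v)) = (\<Sum>\<alpha>=1..n. cscale (c \<alpha>) (Z \<alpha>))"
    and G: "inverse_metric n Z G"
    and inv: "\<And>v w. v \<in> cvec.hor u \<Longrightarrow> w \<in> cvec.hor u \<Longrightarrow> A (\<i> *s v) \<bullet> (\<i> *s w) = A v \<bullet> w"
  shows "complex_of_real (\<Sum>e\<in>Basis. A (cvec.hproj u e) \<bullet> cvec.hproj u e) =
    2 * (\<Sum>\<alpha>=1..n. \<Sum>\<beta>=1..n. G \<alpha> \<beta> * gC (Z \<alpha>) (complexify A (cbar (Z \<beta>))))"
proof -
  define P where "P = cvec.hproj u"
  define W where "W v = (v, - (\<i> *s v))" for v :: "complex ^ 'k"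
  define h where "h Z Z' = gC Z (complexify A (cbar Z'))" for Z Z' :: "'k cvec"
  have P: "P v \<in> cvec.hor u" for v unfolding P_def by (rule cvec.hproj_in_hor[OF u])
  \<comment> \<open>Contraction with the inverse metric recovers the coefficients of
    \<open>W v\<close> in the frame.\<close>
  have expand: "W v = (\<Sum>\<alpha>=1..n. cscale (\<Sum>\<beta>=1..n. G \<alpha> \<beta> * gC (W v) (cbar (Z \<beta>))) (Z \<alpha>))"
    if v: "v \<in> cvec.hor u" for v
  proof -
    obtain c where c: "W v = (\<Sum>\<alpha>=1..n. cscale (c \<alpha>) (Z \<alpha>))" using span[OF v] by (auto simp: W_def)
    have "(\<Sum>\<beta>=1..n. G \<alpha> \<beta> * gC (W v) (cbar (Z \<beta>))) = c \<alpha>" if \<alpha>: "\<alpha> \<in> {1..n}" for \<alpha>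
    proof -
      have "(\<Sum>\<beta>=1..n. G \<alpha> \<beta> * gC (W v) (cbar (Z \<beta>))) =
          (\<Sum>\<beta>=1..n. \<Sum>\<gamma>=1..n. c \<gamma> * (G \<alpha> \<beta> * gC (Z \<gamma>) (cbar (Z \<beta>))))"
        by (simp add: c gC_sum gC_cscale sum_distrib_left mult_ac)
      also have "\<dots> = (\<Sum>\<gamma>=1..n. c \<gamma> * (\<Sum>\<beta>=1..n. G \<alpha> \<beta> * gC (Z \<gamma>) (cbar (Z \<beta>))))"
        by (subst sum.swap) (simp add: sum_distrib_left)
      also have "\<dots> = (\<Sum>\<gamma>=1..n. if \<gamma> = \<alpha> then c \<gamma> else 0)"
        using G \<alpha> unfolding inverse_metric_def by (intro sum.cong refl) auto
      also have "\<dots> = c \<alpha>" using \<alpha> by simp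
      finally show ?thesis .
    qed
    then have "(\<Sum>\<alpha>=1..n. cscale (\<Sum>\<beta>=1..n. G \<alpha> \<beta> * gC (W v) (cbar (Z \<beta>))) (Z \<alpha>)) = (\<Sum>\<alpha>=1..n. cscale (c \<alpha>) (Z \<alpha>))"
      by (intro sum.cong) auto
    then show ?thesis using c by simp
  qed
  \<comment> \<open>One factor 2 comes from the pairing of \<open>W (P e)\<close> with the conjugate
    frame vector, the other from \<open>X \<beta>\<close> and \<open>J (X \<beta>)\<close>
    contributing equally to the sum over a real basis.\<close>
  have inner_sum: "(\<Sum>e\<in>Basis. gC (W (P e)) (cbar (Z \<beta>)) * h (Z \<alpha>) (W (P e))) = 4 * h (Z \<alpha>) (Z \<beta>)"
    if \<alpha>: "\<alpha> \<in> {1..n}" and \<beta>: "\<beta> \<in> {1..n}" for \<alpha> \<beta>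
  proof -
    define a where "a v = X \<alpha> \<bullet> A v + (\<i> *s X \<alpha>) \<bullet> A (\<i> *s v)" for v
    define b where "b v = X \<alpha> \<bullet> A (\<i> *s v) - (\<i> *s X \<alpha>) \<bullet> A v" for v
    have lin: "linear (\<lambda>e. a (P e))" "linear (\<lambda>e. b (P e))"
      unfolding a_def b_def P_def
      by (auto intro!: linearI simp: cvec.J_linear_simps linear_add[OF A(1)] linear_cmul[OF A(1)]
          linear_add[OF cvec.linear_hproj] linear_cmul[OF cvec.linear_hproj] algebra_simps)
    have neg: "A (- v) = - A v" for v by (rule linear_neg[OF A(1)])
    have h: "h (Z \<alpha>) (W v) = Complex (a v) (b v)" for v
      by (simp add: h_def W_def Z(2)[OF \<alpha>] gC_def complexify_def cbar_def a_def b_def)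
    have ab: "a (\<i> *s v) = b v" "b (\<i> *s v) = - a v" for v
      unfolding a_def b_def cvec.J_J neg by (simp_all add: algebra_simps)
    have J\<beta>: "\<i> *s X \<beta> \<in> cvec.hor u" by (rule cvec.J_hor[OF Z(1)[OF \<beta>]])
    have "gC (W (P e)) (cbar (Z \<beta>)) = Complex (2 * (e \<bullet> X \<beta>)) (2 * (e \<bullet> (\<i> *s X \<beta>)))" for e
    proof -
      have "P e \<bullet> X \<beta> = e \<bullet> X \<beta>" "P e \<bullet> (\<i> *s X \<beta>) = e \<bullet> (\<i> *s X \<beta>)"
        unfolding P_def using cvec.hproj_inner_hor Z(1)[OF \<beta>] J\<beta> by auto
      then show ?thesis
        by (simp add: W_def Z(2)[OF \<beta>] gC_def cbar_def cvec.J_isometry cvec.J_skew)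
    qed
    then have "(\<Sum>e\<in>Basis. gC (W (P e)) (cbar (Z \<beta>)) * h (Z \<alpha>) (W (P e))) =
      (\<Sum>e\<in>Basis. 2 * Complex ((e \<bullet> X \<beta>) * a (P e) - (e \<bullet> (\<i> *s X \<beta>)) * b (P e))
         ((e \<bullet> X \<beta>) * b (P e) + (e \<bullet> (\<i> *s X \<beta>)) * a (P e)))"
      by (intro sum.cong refl) (simp add: h complex_eq_iff algebra_simps)
    also have "\<dots> = 2 * Complex (a (P (X \<beta>)) - b (P (\<i> *s X \<beta>))) (b (P (X \<beta>)) + a (P (\<i> *s X \<beta>)))"
      using sum_Basis_inner_linear[OF lin(1), of _ 1] sum_Basis_inner_linear[OF lin(2), of _ 1]
      by (simp add: complex_eq_iff sum_distrib_left[symmetric] sum.distrib sum_subtractf)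
    also have "\<dots> = 4 * Complex (a (X \<beta>)) (b (X \<beta>))"
      using cvec.hproj_hor[OF Z(1)[OF \<beta>]] cvec.hproj_hor[OF J\<beta>]
      by (simp add: P_def ab complex_eq_iff)
    also have "\<dots> = 4 * h (Z \<alpha>) (Z \<beta>)" using h[of "X \<beta>"] by (simp add: W_def Z(2)[OF \<beta>])
    finally show ?thesis .
  qed
  have diag: "h (W v) (W v) = complex_of_real (2 * (A v \<bullet> v))" if v: "v \<in> cvec.hor u" for v
  proof -
    have "v \<bullet> A (\<i> *s v) = (\<i> *s v) \<bullet> A v" using A(2)[of v "\<i> *s v"] by (simp add: inner_commute)
    moreover have "(\<i> *s v) \<bullet> A (\<i> *s v) = A v \<bullet> v" using inv[OF v v] by (simp add: inner_commute)
    ultimately show ?thesis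
      by (simp add: h_def W_def gC_def complexify_def cbar_def complex_eq_iff inner_commute[of v "A v"])
  qed
  \<comment> \<open>The diagonal values carry a factor 2 and the contraction a factor 4; their
    quotient is the 2 of the claim.\<close>
  have "complex_of_real (2 * (\<Sum>e\<in>Basis. A (P e) \<bullet> P e)) = (\<Sum>e\<in>Basis. h (W (P e)) (W (P e)))"
    by (simp add: diag[OF P] sum_distrib_left)
  also have "\<dots> = (\<Sum>e\<in>Basis. \<Sum>\<alpha>=1..n. \<Sum>\<beta>=1..n. G \<alpha> \<beta> * (gC (W (P e)) (cbar (Z \<beta>)) * h (Z \<alpha>) (W (P e))))"
  proof (intro sum.cong refl)
    fix e :: "complex ^ 'k"
    have "h (W (P e)) (W (P e)) =
        h (\<Sum>\<alpha>=1..n. cscale (\<Sum>\<beta>=1..n. G \<alpha> \<beta> * gC (W (P e)) (cbar (Z \<beta>))) (Z \<alpha>)) (W (P e))"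
      using expand[OF P[of e]] by metis
    then show "h (W (P e)) (W (P e)) =
        (\<Sum>\<alpha>=1..n. \<Sum>\<beta>=1..n. G \<alpha> \<beta> * (gC (W (P e)) (cbar (Z \<beta>)) * h (Z \<alpha>) (W (P e))))"
      by (simp add: h_def gC_sum gC_cscale sum_distrib_right mult.assoc)
  qed
  also have "\<dots> = (\<Sum>\<alpha>=1..n. \<Sum>\<beta>=1..n. G \<alpha> \<beta> * (\<Sum>e\<in>Basis. gC (W (P e)) (cbar (Z \<beta>)) * h (Z \<alpha>) (W (P e))))"
    unfolding sum_distrib_left by (subst sum.swap, intro sum.cong refl, subst sum.swap) simp
  also have "\<dots> = (\<Sum>\<alpha>=1..n. \<Sum>\<beta>=1..n. G \<alpha> \<beta> * (4 * h (Z \<alpha>) (Z \<beta>)))"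
    by (intro sum.cong refl) (simp only: inner_sum)
  also have "\<dots> = 4 * (\<Sum>\<alpha>=1..n. \<Sum>\<beta>=1..n. G \<alpha> \<beta> * h (Z \<alpha>) (Z \<beta>))"
    by (simp add: sum_distrib_left mult_ac)
  finally show ?thesis unfolding h_def P_def by simp
qed

lemma ex_levi_germ:
  fixes M :: "(complex ^ 'k::finite) set"
  assumes n: "n \<ge> 1" and hyp: "smooth_hypersurface M" and nf: "unit_normal_field M \<nu>"
    and H: "H \<noteq> 0" "\<And>p. p \<in> M \<Longrightarrow> has_levi_curvature n M \<nu> p H"
    and sff: "\<And>p Z W. p \<in> M \<Longrightarrow> Z \<in> hol_tangent_space M p \<Longrightarrow> W \<in> hol_tangent_space M p \<Longrightarrow> second_ff M \<nu> p Z W = 0"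
    and s: "s \<noteq> 0" "levi_psd M (\<lambda>p. s *\<^sub>R \<nu> p)" and p: "p \<in> M"
  obtains V A t \<tau> where "open V" "p \<in> V" "levi_germ (\<lambda>v. \<i> *s v) (M \<inter> V) \<nu> A t s \<tau>"
proof -
  obtain V \<phi> where V: "open V" "p \<in> V" and C: "\<And>k. Ck_on k \<phi> V" and "M \<inter> V = {x \<in> V. \<phi> x = 0}"
    and gr: "\<And>x. x \<in> M \<inter> V \<Longrightarrow> grad \<phi> x = \<nu> x"
    by (fact normal_potential[OF hyp nf p])
  obtain A t where dG: "\<And>x. x \<in> V \<Longrightarrow> (grad \<phi> has_derivative A x) (at x)"
    and dA: "\<And>x v. x \<in> V \<Longrightarrow> ((\<lambda>y. A y v) has_derivative (\<lambda>X. t x X v)) (at x)"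
    and A_sym: "\<And>x v w. x \<in> V \<Longrightarrow> A x v \<bullet> w = v \<bullet> A x w"
    and t1: "\<And>x X v w. x \<in> V \<Longrightarrow> t x X v \<bullet> w = t x v X \<bullet> w"
    and t2: "\<And>x X v w. x \<in> V \<Longrightarrow> t x X v \<bullet> w = t x X w \<bullet> v"
    by (fact hessian_exists[OF V(1) C])
  have lin: "linear (A x)" if "x \<in> V" for x using dG[OF that] by (rule has_derivative_linear)
  have within: "at x within M \<inter> V = at x within M" if "x \<in> V" for x
    by (rule at_within_nhd[OF that V(1)]) blast
  have d\<nu>: "(\<nu> has_derivative A x) (at x within M \<inter> V)" if x: "x \<in> M \<inter> V" for x
    by (rule has_derivative_transform[OF x _ has_derivative_at_withinI[OF dG]]) (use gr x in auto)
  have d\<nu>': "frechet_derivative \<nu> (at x within M) X = A x X"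
    "frechet_derivative (\<lambda>p. s *\<^sub>R \<nu> p) (at x within M) X = s *\<^sub>R A x X"
    if x: "x \<in> M \<inter> V" and X: "X \<bullet> \<nu> x = 0" for x X
  proof -
    have d: "(\<nu> has_derivative A x) (at x within M)" using d\<nu>[OF x] within x by auto
    show "frechet_derivative \<nu> (at x within M) X = A x X"
      using frechet_derivative_tangent[OF hyp nf _ d X] x by blast
    show "frechet_derivative (\<lambda>p. s *\<^sub>R \<nu> p) (at x within M) X = s *\<^sub>R A x X"
      using frechet_derivative_tangent[OF hyp nf _ has_derivative_scaleR_right[OF d] X] x by blast
  qed
  have hol: "(v, - (\<i> *s v)) \<in> hol_tangent_space M x" if "x \<in> M" "v \<in> cvec.hor (\<nu> x)" for x v
    using hol_tangent_space_iff[OF hyp nf that(1)] that(2) by blast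
  have horD: "v \<bullet> \<nu> x = 0" "(\<i> *s v) \<bullet> \<nu> x = 0" "- (\<i> *s v) \<bullet> \<nu> x = 0" if "v \<in> cvec.hor (\<nu> x)" for x v
    using cvec.horD(1)[OF that] cvec.horD(1)[OF cvec.J_hor[OF that]] by auto
  have nrm: "norm (\<nu> x) = 1" if "x \<in> M" for x using nf that by (auto simp: unit_normal_field_def)
  have inv: "A x (\<i> *s v) \<bullet> (\<i> *s w) = A x v \<bullet> w"
    if x: "x \<in> M \<inter> V" and v: "v \<in> cvec.hor (\<nu> x)" and w: "w \<in> cvec.hor (\<nu> x)" for x v w
  proof -
    have xV: "x \<in> V" and xM: "x \<in> M" using x by auto
    have "second_ff M \<nu> x (w, - (\<i> *s w)) (v, - (\<i> *s v)) = 0"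
      by (rule sff[OF xM hol[OF xM w] hol[OF xM v]])
    then have "w \<bullet> A x v - (\<i> *s w) \<bullet> A x (\<i> *s v) = 0"
      by (simp add: second_ff_def gC_def complexify_def d\<nu>'(1)[OF x] horD[OF v] linear_neg[OF lin[OF xV]] complex_eq_iff)
    then show ?thesis by (simp add: inner_commute)
  qed
  have sgn: "0 \<le> s * (A x v \<bullet> v)" if x: "x \<in> M \<inter> V" and v: "v \<in> cvec.hor (\<nu> x)" for x v
  proof -
    have xM: "x \<in> M" using x by auto
    have "second_ff M (\<lambda>p. s *\<^sub>R \<nu> p) x (v, - (\<i> *s v)) (cbar (v, - (\<i> *s v))) \<in> \<real>\<^sub>\<ge>\<^sub>0"
      using s(2) hol[OF xM v] xM unfolding levi_psd_def by blast
    then have "0 \<le> s * (v \<bullet> A x v) + s * ((\<i> *s v) \<bullet> A x (\<i> *s v))"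
      by (simp add: second_ff_def gC_def complexify_def cbar_def d\<nu>'(2)[OF x] horD[OF v] complex_nonneg_Reals_iff)
    moreover have "(\<i> *s v) \<bullet> A x (\<i> *s v) = A x v \<bullet> v" using inv[OF x v v] by (simp add: inner_commute)
    ultimately show ?thesis by (simp add: inner_commute)
  qed
  have tr: "complex_of_real (\<Sum>e\<in>Basis. A x (cvec.hproj (\<nu> x) e) \<bullet> cvec.hproj (\<nu> x) e) = 2 * of_nat n * H"
    if x: "x \<in> M \<inter> V" for x
  proof -
    have xV: "x \<in> V" and xM: "x \<in> M" using x by auto
    obtain Z G where Z: "hol_frame_at n M x Z" and G: "inverse_metric n Z G"
      and HZ: "H = 1 / of_nat n * (\<Sum>\<alpha>=1..n. \<Sum>\<beta>=1..n. G \<alpha> \<beta> * second_ff M \<nu> x (Z \<alpha>) (cbar (Z \<beta>)))"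
      using H(2)[OF xM] unfolding has_levi_curvature_def by blast
    define X where "X \<alpha> = fst (Z \<alpha>)" for \<alpha>
    have X: "X \<alpha> \<in> cvec.hor (\<nu> x)" "Z \<alpha> = (X \<alpha>, - (\<i> *s X \<alpha>))" if "\<alpha> \<in> {1..n}" for \<alpha>
      using Z that unfolding hol_frame_at_def hol_tangent_space_iff[OF hyp nf xM] X_def by (metis fst_conv)+
    have "complex_of_real (\<Sum>e\<in>Basis. A x (cvec.hproj (\<nu> x) e) \<bullet> cvec.hproj (\<nu> x) e) =
        2 * (\<Sum>\<alpha>=1..n. \<Sum>\<beta>=1..n. G \<alpha> \<beta> * gC (Z \<alpha>) (complexify (A x) (cbar (Z \<beta>))))"
    proof (rule levi_trace_frame[OF lin[OF xV] A_sym[OF xV] nrm[OF xM] X _ G inv[OF x]])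
      fix v assume "v \<in> cvec.hor (\<nu> x)"
      then show "\<exists>c. (v, - (\<i> *s v)) = (\<Sum>\<alpha>=1..n. cscale (c \<alpha>) (Z \<alpha>))"
        using Z hol[OF xM] unfolding hol_frame_at_def by blast
    qed
    also have "\<dots> = 2 * (\<Sum>\<alpha>=1..n. \<Sum>\<beta>=1..n. G \<alpha> \<beta> * second_ff M \<nu> x (Z \<alpha>) (cbar (Z \<beta>)))"
    proof -
      have "complexify (A x) (cbar (Z \<beta>)) = complexify (frechet_derivative \<nu> (at x within M)) (cbar (Z \<beta>))"
        if "\<beta> \<in> {1..n}" for \<beta>
        using horD[OF X(1)[OF that]] by (simp add: complexify_def cbar_def X(2)[OF that] d\<nu>'(1)[OF x])
      then show ?thesis by (simp add: second_ff_def)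
    qed
    also have "\<dots> = 2 * of_nat n * H" using n HZ by simp
    finally show ?thesis .
  qed
  \<comment> \<open>The horizontal space has real dimension \<open>2 * n\<close>, so its real trace
    is \<open>2 * n\<close> times the normalised trace \<open>H\<close>. By \<open>tr\<close>,
    \<open>H\<close> is real, hence \<open>Re\<close> loses nothing and
    \<open>\<tau> \<noteq> 0\<close>.\<close>
  define \<tau> where "\<tau> = 2 * real n * Re H"
  have \<tau>: "(\<Sum>e\<in>Basis. A x (cvec.hproj (\<nu> x) e) \<bullet> cvec.hproj (\<nu> x) e) = \<tau>" if "x \<in> M \<inter> V" for x
    using arg_cong[OF tr[OF that], of Re] by (simp add: \<tau>_def)
  have pV: "p \<in> M \<inter> V" using p V by simp
  have "\<tau> \<noteq> 0" using tr[OF pV] n H(1) unfolding \<tau>[OF pV] by auto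
  moreover have "0 \<le> s * \<tau>"
    unfolding \<tau>[OF pV, symmetric] sum_distrib_left
    by (intro sum_nonneg sgn[OF pV] cvec.hproj_in_hor nrm[OF p])
  ultimately have pos: "0 < s * \<tau>" using s(1) by (simp add: less_le)
  have "levi_germ (\<lambda>v. \<i> *s v) (M \<inter> V) \<nu> A t s \<tau>"
  proof (rule levi_germ.intro[OF complex_structure_vec levi_germ_axioms.intro])
    show "((\<lambda>y. A y v) has_derivative (\<lambda>X. t x X v)) (at x within M \<inter> V)" if "x \<in> M \<inter> V" for x v
      using dA that has_derivative_at_withinI by blast
    show "D X = 0" if "(f has_derivative D) (at x within M \<inter> V)" "x \<in> M \<inter> V"
      "\<forall>y\<in>M \<inter> V. f y = c" "X \<bullet> \<nu> x = 0" for f :: "complex ^ 'k \<Rightarrow> real" and D x c X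
      by (rule tangent_derivative_zero[OF hyp nf V(1) that(2,1,3,4)])
  qed (use d\<nu> nrm A_sym t1 t2 inv sgn \<tau> pos in auto)
  with V show thesis by (rule that)
qed

section \<open>From the local pieces to the whole hypersurface\<close>

theorem theorem5p2:
  fixes n :: nat
    and e :: "nat \<Rightarrow> 'k::finite"
    and M :: "(complex ^ 'k) set"
    and \<nu> :: "complex ^ 'k \<Rightarrow> complex ^ 'k"
  assumes "n \<ge> 1"
    and "CARD('k) = n + 1"
    and "bij_betw e {1..n+1} (UNIV :: 'k set)"
    and "smooth_hypersurface M"
    and "connected M"
    and "unit_normal_field M \<nu>"
    and "pseudoconvex M \<nu>"
    and "\<exists>H. H \<noteq> 0 \<and> (\<forall>p\<in>M. has_levi_curvature n M \<nu> p H)"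
    and "\<forall>p\<in>M. \<forall>Z\<in>hol_tangent_space M p. \<forall>W\<in>hol_tangent_space M p. second_ff M \<nu> p Z W = 0"
  shows "\<exists>\<Phi>. complex_isometry \<Phi> \<and>
           ((\<exists>a r. r > 0 \<and> \<Phi> ` M \<subseteq> sphere a r) \<or>
            (\<exists>m r. 1 \<le> m \<and> m \<le> n \<and> r > 0 \<and> \<Phi> ` M \<subseteq> spherical_cylinder n e m r))"
proof (cases "M = {}")
  case True
  have "map_matrix cnj (transpose (mat 1)) = (mat 1 :: complex ^ 'k ^ 'k)"
    by (simp add: map_matrix_def mat_def vec_eq_iff transpose_def)
  then have "unitary_matrix (mat 1 :: complex ^ 'k ^ 'k)" by (simp add: unitary_matrix_def)
  then have "complex_isometry (\<lambda>z :: complex ^ 'k. mat 1 *v z + 0)"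
    unfolding complex_isometry_def by blast
  moreover have "(1::real) > 0" by simp
  ultimately show ?thesis using True by blast
next
  case False
  then obtain p0 where p0: "p0 \<in> M" by blast
  note hyp = \<open>smooth_hypersurface M\<close> and nf = \<open>unit_normal_field M \<nu>\<close>
  obtain H where H: "H \<noteq> 0" "\<And>p. p \<in> M \<Longrightarrow> has_levi_curvature n M \<nu> p H" using assms(8) by blast
  \<comment> \<open>The choice of orientation is stored in the scalar \<open>s\<close>, so that
    \<open>\<nu>\<close> itself stays fixed.\<close>
  have "levi_psd M (\<lambda>p. 1 *\<^sub>R \<nu> p) \<or> levi_psd M (\<lambda>p. (- 1) *\<^sub>R \<nu> p)"
    using \<open>pseudoconvex M \<nu>\<close> by (simp add: pseudoconvex_def)
  then obtain s :: real where s: "s \<noteq> 0" "levi_psd M (\<lambda>p. s *\<^sub>R \<nu> p)"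
    by (metis zero_neq_neg_one zero_neq_one)
  \<comment> \<open>Global counterparts of \<open>A\<close>, \<open>curv\<close> and
    \<open>kerproj\<close>, defined from \<open>\<nu>\<close> alone. They agree with the local ones
    because the operators are applied to tangent vectors only.\<close>
  define S where "S x = frechet_derivative \<nu> (at x within M)" for x
  define c where "c x = S x (\<i> *s \<nu> x) \<bullet> (\<i> *s \<nu> x)" for x
  define K where "K k x v = (v - (v \<bullet> \<nu> x) *\<^sub>R \<nu> x) - (1 / k) *\<^sub>R S x (v - (v \<bullet> \<nu> x) *\<^sub>R \<nu> x)" for k x v
  have germ: "\<exists>V A t \<tau>. open V \<and> x \<in> V \<and> levi_germ (\<lambda>v. \<i> *s v) (M \<inter> V) \<nu> A t s \<tau>" if "x \<in> M" for x
    by (rule ex_levi_germ[OF assms(1) hyp nf H _ s that]) (use assms(9) in blast)+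
  have within: "at x within M \<inter> V = at x within M" if "x \<in> V" "open V" for x :: "complex ^ 'k" and V
    by (rule at_within_nhd[OF that]) blast
  have S_eq: "S x X = A x X"
    if "levi_germ (\<lambda>v. \<i> *s v) (M \<inter> V) \<nu> A t s \<tau>" "open V" "x \<in> M \<inter> V" "X \<bullet> \<nu> x = 0" for x X V A t \<tau>
    using frechet_derivative_tangent[OF hyp nf _ _ that(4), of "\<nu>" "A x"] levi_germ.deriv_\<nu>[OF that(1,3)]
      within[OF _ that(2), of x] that(3) by (simp add: S_def)
  have c_eq: "c x = levi_germ.curv (\<lambda>v. \<i> *s v) \<nu> A x"
    if g: "levi_germ (\<lambda>v. \<i> *s v) (M \<inter> V) \<nu> A t s \<tau>" and "open V" "x \<in> M \<inter> V" for x V A t \<tau>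
    using S_eq[OF that cvec.J_orthogonal(1)] by (simp add: c_def levi_germ.curv_def[OF g])
  have K_eq: "K k x v = levi_germ.kerproj \<nu> A k x v"
    if g: "levi_germ (\<lambda>v. \<i> *s v) (M \<inter> V) \<nu> A t s \<tau>" and "open V" "x \<in> M \<inter> V" for x V A t \<tau> k v
  proof -
    have "(v - (v \<bullet> \<nu> x) *\<^sub>R \<nu> x) \<bullet> \<nu> x = 0"
      using levi_germ.\<nu>_inner(1)[OF g that(3)] by (simp add: inner_diff_left)
    then show ?thesis using S_eq[OF that] by (simp add: K_def levi_germ.kerproj_def[OF g])
  qed
  have "c constant_on M"
  proof (rule constant_on_hypersurface[OF hyp nf \<open>connected M\<close>])
    fix x assume x: "x \<in> M"
    obtain V A t \<tau> where V: "open V" "x \<in> V" and g: "levi_germ (\<lambda>v. \<i> *s v) (M \<inter> V) \<nu> A t s \<tau>"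
      using germ[OF x] by blast
    have xN: "x \<in> M \<inter> V" using x V by simp
    note D = has_derivative_transform[OF xN c_eq[OF g V(1)] levi_germ.curv_deriv[OF g xN],
        unfolded within[OF V(2,1)]]
    show "\<exists>D. (c has_derivative D) (at x within M) \<and> (\<forall>X. X \<bullet> \<nu> x = 0 \<longrightarrow> D X = 0)"
      using D levi_germ.curv_deriv_zero[OF g xN] by blast
  qed
  then obtain k where k: "\<And>x. x \<in> M \<Longrightarrow> c x = k" unfolding constant_on_def by blast
  have curv_k: "levi_germ.curv (\<lambda>v. \<i> *s v) \<nu> A x = k"
    if "levi_germ (\<lambda>v. \<i> *s v) (M \<inter> V) \<nu> A t s \<tau>" "open V" "x \<in> M \<inter> V" for x V A t \<tau>
    using c_eq[OF that] k that(3) by simp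
  have "(\<lambda>x. K k x v) constant_on M" for v
  proof (rule constant_on_hypersurface[OF hyp nf \<open>connected M\<close>])
    fix x assume x: "x \<in> M"
    obtain V A t \<tau> where V: "open V" "x \<in> V" and g: "levi_germ (\<lambda>v. \<i> *s v) (M \<inter> V) \<nu> A t s \<tau>"
      using germ[OF x] by blast
    have xN: "x \<in> M \<inter> V" using x V by simp
    obtain D where D: "((\<lambda>y. levi_germ.kerproj \<nu> A k y v) has_derivative D) (at x within M \<inter> V)"
      "\<And>X. X \<bullet> \<nu> x = 0 \<Longrightarrow> D X = 0"
      using levi_germ.kerproj_deriv[OF g curv_k[OF g V(1)] xN] by blast
    have "((\<lambda>x. K k x v) has_derivative D) (at x within M)"
      using has_derivative_transform[OF xN K_eq[OF g V(1)] D(1)] unfolding within[OF V(2,1)] .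
    then show "\<exists>D. ((\<lambda>x. K k x v) has_derivative D) (at x within M) \<and> (\<forall>X. X \<bullet> \<nu> x = 0 \<longrightarrow> D X = 0)"
      using D(2) by blast
  qed
  then have K_const: "K k x v = K k p0 v" if "x \<in> M" for x v
    using that p0 unfolding constant_on_def by metis
  define P where "P = K k p0"
  define R where "R z = z - P z" for z
  obtain V0 A0 t0 \<tau>0 where V0: "open V0" "p0 \<in> V0" and g0: "levi_germ (\<lambda>v. \<i> *s v) (M \<inter> V0) \<nu> A0 t0 s \<tau>0"
    using germ[OF p0] by blast
  have p0N: "p0 \<in> M \<inter> V0" using p0 V0 by simp
  have P_eq: "levi_germ.kerproj \<nu> A0 k p0 v = P v" for v
    using K_eq[OF g0 V0(1) p0N] by (simp add: P_def)
  have P_fun: "levi_germ.kerproj \<nu> A0 k p0 = P" using P_eq by blast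
  note Pp = levi_germ.kerproj_props[OF g0 p0N curv_k[OF g0 V0(1) p0N], unfolded P_fun]
  have k0: "k \<noteq> 0" using levi_germ.curv_nonzero[OF g0 p0N] curv_k[OF g0 V0(1) p0N] by simp
  have P\<nu>: "P (\<nu> x) = 0" and PX: "X \<bullet> \<nu> x = 0 \<Longrightarrow> P X = X - (1 / k) *\<^sub>R S x X" if x: "x \<in> M" for x X
  proof -
    have n1: "\<nu> x \<bullet> \<nu> x = 1" using nf x by (auto simp: unit_normal_field_def norm_eq_1)
    obtain V A t \<tau> where V: "open V" "x \<in> V" and g: "levi_germ (\<lambda>v. \<i> *s v) (M \<inter> V) \<nu> A t s \<tau>"
      using germ[OF x] by blast
    have xN: "x \<in> M \<inter> V" using x V by simp
    show "P (\<nu> x) = 0"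
      using levi_germ.kerproj_props(5)[OF g xN curv_k[OF g V(1) xN]] K_eq[OF g V(1) xN] K_const[OF x]
      by (simp add: P_def)
    show "X \<bullet> \<nu> x = 0 \<Longrightarrow> P X = X - (1 / k) *\<^sub>R S x X"
      using K_const[OF x, of X] by (simp add: P_def K_def)
  qed
  have lP: "linear P" by (rule Pp(1))
  \<comment> \<open>On tangent vectors the derivative of \<open>\<nu>\<close> divided by
    \<open>k\<close> is exactly \<open>R\<close>, by \<open>PX\<close>.\<close>
  have "(\<lambda>x. R x - (1 / k) *\<^sub>R \<nu> x) constant_on M"
  proof (rule constant_on_hypersurface[OF hyp nf \<open>connected M\<close>])
    fix x assume x: "x \<in> M"
    obtain V A t \<tau> where V: "open V" "x \<in> V" and g: "levi_germ (\<lambda>v. \<i> *s v) (M \<inter> V) \<nu> A t s \<tau>"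
      using germ[OF x] by blast
    have xN: "x \<in> M \<inter> V" using x V by simp
    have d\<nu>: "(\<nu> has_derivative A x) (at x within M)"
      using levi_germ.deriv_\<nu>[OF g xN] unfolding within[OF V(2,1)] .
    have "((\<lambda>x. R x - (1 / k) *\<^sub>R \<nu> x) has_derivative (\<lambda>X. X - P X - (1 / k) *\<^sub>R A x X)) (at x within M)"
      unfolding R_def
      by (intro has_derivative_diff has_derivative_ident has_derivative_scaleR_right d\<nu>
          bounded_linear_imp_has_derivative) (use lP linear_conv_bounded_linear in blast)
    moreover have "X - P X - (1 / k) *\<^sub>R A x X = 0" if X: "X \<bullet> \<nu> x = 0" for X
      using PX[OF x X] S_eq[OF g V(1) xN X] by simp
    ultimately show "\<exists>D. ((\<lambda>x. R x - (1 / k) *\<^sub>R \<nu> x) has_derivative D) (at x within M) \<and> (\<forall>X. X \<bullet> \<nu> x = 0 \<longrightarrow> D X = 0)"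
      by blast
  qed
  then obtain a where a: "\<And>x. x \<in> M \<Longrightarrow> R x - (1 / k) *\<^sub>R \<nu> x = a" unfolding constant_on_def by blast
  have R: "linear R" "R (R v) = R v" "R v \<bullet> w = v \<bullet> R w" "R (\<i> *s v) = \<i> *s R v" for v w
  proof -
    show "linear R" unfolding R_def by (rule linear_compose_sub[OF linear_ident lP])
    show "R (R v) = R v" by (simp add: R_def linear_diff[OF lP] Pp(2))
    show "R v \<bullet> w = v \<bullet> R w" by (simp add: R_def inner_diff_left inner_diff_right Pp(3))
    show "R (\<i> *s v) = \<i> *s R v" by (simp add: R_def Pp(4) cvec.J_linear_simps)
  qed
  have R\<nu>: "R (\<nu> x) = \<nu> x" if "x \<in> M" for x using P\<nu>[OF that] by (simp add: R_def)
  \<comment> \<open>\<open>a\<close> is a difference of vectors in the range of \<open>R\<close>;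
    therefore \<open>R (x - a)\<close> is the normal divided by \<open>k\<close>, of norm
    \<open>1 / \<bar>k\<bar>\<close>.\<close>
  have Ra: "R a = a"
    using a[OF p0] R\<nu>[OF p0] R(2) linear_diff[OF R(1)] linear_cmul[OF R(1)] by metis
  have nrm: "norm (\<nu> x) = 1" if "x \<in> M" for x using nf that by (auto simp: unit_normal_field_def)
  obtain w where w: "w \<in> cvec.hor (\<nu> p0)" "w \<noteq> 0" "P w = 0" using Pp(7) by blast
  have Rw: "R w = w" using w(3) by (simp add: R_def)
  obtain U m where U: "unitary_matrix U" and m: "1 \<le> m" "m \<le> n"
    and Un: "\<And>z. (\<Sum>i=m..n+1. (cmod ((U *v z) $ e i))\<^sup>2) = (norm (R z))\<^sup>2"
    by (fact projection_norm_isometry[OF assms(2,3) R nrm[OF p0] R\<nu>[OF p0] w(1,2) Rw])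
  define \<Phi> where "\<Phi> z = U *v z + U *v (- a)" for z
  have "complex_isometry \<Phi>" unfolding complex_isometry_def \<Phi>_def[abs_def] using U by blast
  \<comment> \<open>The translation part of \<open>\<Phi>\<close> moves \<open>a\<close> to the
    origin. For \<open>m = 1\<close> this set is the sphere of radius
    \<open>1 / \<bar>k\<bar>\<close> about the origin.\<close>
  moreover have "\<Phi> ` M \<subseteq> spherical_cylinder n e m (1 / \<bar>k\<bar>)"
  proof (rule image_subsetI)
    fix x assume x: "x \<in> M"
    have "\<Phi> x = U *v (x - a)" by (simp add: \<Phi>_def flip: matrix_vector_right_distrib)
    moreover have "R (x - a) = (1 / k) *\<^sub>R \<nu> x"
      using a[OF x] by (simp add: linear_diff[OF R(1)] Ra algebra_simps)
    ultimately show "\<Phi> x \<in> spherical_cylinder n e m (1 / \<bar>k\<bar>)"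
      unfolding spherical_cylinder_def using Un[of "x - a"] nrm[OF x] by simp
  qed
  moreover have "1 / \<bar>k\<bar> > 0" using k0 by simp
  ultimately show ?thesis using m by blast
qed

end
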